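(* Consider the DZOFL iteration $\theta_{k+1}=\theta_k-\alpha_k g_k$, $k\ge 0$, described in the context, with $F=\sum_{i=1}^N F_i$, and assume that there is $\theta^*\in\mathbb{R}^d$ with $\min_{\theta\in\mathbb{R}^d}F(\theta)=F(\theta^* )>-\infty$ and $\nabla F(\theta^* )=0$. Assume: (1) For every $i\in\mathcal N$, $\nabla F_i(\theta)$ and $\nabla^2F_i(\theta)$ exist and are continuous, and there is a constant $\alpha_1>0$ such that $\|\nabla^2F_i(\theta)\|_2\le\alpha_1$ for all $\theta\in\mathbb{R}^d$ and $i\in\mathcal N$. Let $L>0$ be such that $F$ is $L$-smooth, i.e. $\|\nabla F(\theta)-\nabla F(\theta')\|\le L\|\theta-\theta'\|$ for all $\theta,\theta'$. (2) For every $i\in\mathcal N$, $|f_i(\theta,\xi_i)-f_i(\theta',\xi_i)|\le L_{\xi_i}\|\theta-\theta'\|$ for all $\theta,\theta'\in\mathbb{R}^d$, where $L_{\xi_i}$ is a Lipschitz constant depending on $\xi_i$ and $L_\xi:=\max_i\mathbb{E}[L_{\xi_{i,k}}^2\mid\mathcal H_k]$ is a finite constant; moreover $\mathbb{E}_{\xi_i}f_i(\theta,\xi_i)<\infty$. (3) The step sizes are $\alpha_k=\alpha_0(1+k)^{-\upsilon_1}$ and $\gamma_k=\gamma_0(1+k)^{-\upsilon_2}$ with $\alpha_0,\gamma_0,\upsilon_1,\upsilon_2>0$, and with $\upsilon_3:=\upsilon_1+\upsilon_2$ one has $0.5<\upsilon_3<1$ and $\upsilon_1+3\upsilon_2>1$.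 (4) The random quantizer $Q$ satisfies $\mathbb{E}[Q(x)\mid x]=x$ and $\mathbb{E}[\|Q(x)-x\|^2\mid x]\le\sigma\|x\|^2$ for some constant $\sigma>0$ and every argument $x$. (5) The vectors $\Phi_k=(\phi_k^1,\dots,\phi_k^d)^T$ are independent across iterations $k$; for each $k$ the entries of $\Phi_k$ are i.i.d. with $\mathbb{E}(\phi_k^{d_1}\phi_k^{d_2})=0$ for $d_1\ne d_2$; there is $\alpha_2>0$ with $\mathbb{E}(\phi_k^{d_j})^2=\alpha_2$ for all $d_j$ and $k$; and there is $\alpha_3>0$ with $\|\Phi_k\|\le\alpha_3$ for all $k$. Let $q=1-(1-p)^N$, $c_1=2q\alpha_2$, $c_2=4q(\sigma+1)^2\alpha_3^4N^2L_\xi$, $c_3=\frac{\alpha_1\alpha_3^3N}{2\alpha_2}$ and $\delta_0=F(\theta_0)-F(\theta^* )$. Then for every integer $K\geq 1$, $$\frac{\sum_{k=0}^K\alpha_k\gamma_k\,\mathbb{E}\big[\|\nabla F(\theta_k)\|^2\big]}{\sum_{k=0}^K\alpha_k\gamma_k}\le\frac{1-\upsilon_3}{(K+2)^{1-\upsilon_3}-1}\left(A_0+\frac{A_1}{\upsilon_1+3\upsilon_2-1}+\frac{A_2}{2\upsilon_3-1}\right),$$ where $A_0=\frac{2\delta_0}{c_1\alpha_0\gamma_0}$, $A_1=(\upsilon_1+3\upsilon_2)(c_3\gamma_0)^2$ and $A_2=\frac{2\upsilon_3c_2\alpha_0\gamma_0L}{c_1}$.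
   Context: Setting. $\mathcal N=\{1,\dots,N\}$ is a set of devices. For each $i\in\mathcal N$, $F_i(\theta)=\mathbb{E}_{\xi_i\sim D_i}f_i(\theta,\xi_i)$ for $\theta\in\mathbb{R}^d$, where $D_i$ is a distribution (local data), and $F=\sum_{i=1}^NF_i$. The functions may be nonconvex. DZOFL algorithm. The initial point $\theta_0\in\mathbb{R}^d$ is given (deterministic). At each iteration $k\ge0$: samples $\xi_{i,k}\sim D_i$ are drawn (i.i.d. in $k$), and a random perturbation vector $\Phi_k\in\mathbb{R}^d$ is drawn; device $i$ computes $$\Delta f_{i,k}=f_i(\theta_k+\gamma_k\Phi_k,\xi_{i,k})-f_i(\theta_k-\gamma_k\Phi_k,\xi_{i,k})$$ and sends $Q(\Delta f_{i,k})$, where $Q$ is a random quantizer. A random set $\mathcal S_k\subseteq\mathcal N$ of devices has its packets received correctly: independently over $i$ one has $\mathbb{P}(i\in\mathcal S_k)=p$, with $0<p\le1$. The server forms $$\Delta f_k=\frac{N}{|\mathcal S_k|}\sum_{i\in\mathcal S_k}Q(\Delta f_{i,k})\ \text{ if }|\mathcal S_k|\ne0,\qquad \Delta f_k=0\ \text{ if }|\mathcal S_k|=0,$$ and one sets $g_k=\Phi_k\,Q(\Delta f_k)$ (so $g_k=0$ if $\mathcal S_k$ is empty) and $\theta_{k+1}=\theta_k-\alpha_kg_k$, with step sizes $\alpha_k,\gamma_k>0$. Write $\xi_k=(\xi_{1,k},\dots,\xi_{N,k})$ and let $\mathcal H_k=\{\theta_0,\xi_0,\theta_1,\xi_1,\dots,\theta_{k-1},\xi_{k-1},\theta_k\}$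 be the history. At iteration $k$ the quantities $\Phi_k$, $\xi_k$ and $\mathcal S_k$ are independent of each other and of the past, and every application of $Q$ uses fresh randomness independent of everything else (so the quantizer properties hold conditionally on all other variables). *)

theory Defs
  imports "HOL-Probability.Probability"
begin

definition grad :: "(real^'d \<Rightarrow> real) \<Rightarrow> real^'d \<Rightarrow> real^'d" where
  "grad h x = (THE D. GDERIV h x :> D)"

definition hessian :: "(real^'d \<Rightarrow> real) \<Rightarrow> real^'d \<Rightarrow> real^'d^'d" where
  "hessian h x = matrix (frechet_derivative (grad h) (at x))"

definition spectral_norm :: "real^'d^'d \<Rightarrow> real" where
  "spectral_norm A = onorm (\<lambda>v. A *v v)"

definition local_obj ::
    "(nat \<Rightarrow> 'x measure) \<Rightarrow> (nat \<Rightarrow> real^'d \<Rightarrow> 'x \<Rightarrow> real) \<Rightarrow> nat \<Rightarrow> real^'d \<Rightarrow> real" where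
  "local_obj D f i \<theta> = (\<integral>x. f i \<theta> x \<partial>D i)"

definition global_obj ::
    "nat \<Rightarrow> (nat \<Rightarrow> 'x measure) \<Rightarrow> (nat \<Rightarrow> real^'d \<Rightarrow> 'x \<Rightarrow> real) \<Rightarrow> real^'d \<Rightarrow> real" where
  "global_obj N D f \<theta> = (\<Sum>i=1..N. local_obj D f i \<theta>)"

text \<open>A random quantizer of real numbers is a function of a random seed and of its argument.
  \<open>DQ\<close> is the law of the seed, and each application of the quantizer consumes a seed of
  its own. The integrability conditions are explicit because the integral of a non-integrable
  function is 0 by convention.\<close>

definition unbiased_quantizer :: "'q measure \<Rightarrow> ('q \<Rightarrow> real \<Rightarrow> real) \<Rightarrow> real \<Rightarrow> bool" where
  "unbiased_quantizer DQ Q \<sigma> \<longleftrightarrow>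
     prob_space DQ \<and>
     (\<lambda>(s, x). Q s x) \<in> borel_measurable (DQ \<Otimes>\<^sub>M borel) \<and>
     (\<forall>x. integrable DQ (\<lambda>s. Q s x) \<and> (\<integral>s. Q s x \<partial>DQ) = x) \<and>
     (\<forall>x. integrable DQ (\<lambda>s. (norm (Q s x - x))\<^sup>2) \<and>
          (\<integral>s. (norm (Q s x - x))\<^sup>2 \<partial>DQ) \<le> \<sigma> * (norm x)\<^sup>2)"

definition server_average :: "nat \<Rightarrow> nat set \<Rightarrow> (nat \<Rightarrow> real) \<Rightarrow> real" where
  "server_average N S y =
     (if card S \<noteq> 0 then real N / real (card S) * (\<Sum>i\<in>S. y i) else 0)"

text \<open>The elementary random draws: the argument \<open>k\<close> is the iteration, \<open>i\<close> the device.
  The draw \<open>Sample k\<close> is the whole vector of the device samples at iteration \<open>k\<close>;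
  nothing is imposed on the dependence among its entries.\<close>

datatype draw = Perturb nat | Sample nat | Receive nat | DeviceSeed nat nat | ServerSeed nat

definition draws :: "nat \<Rightarrow> draw set" where
  "draws N = range Perturb \<union> range Sample \<union> range Receive \<union> range ServerSeed
     \<union> {DeviceSeed i k | i k. i \<in> {1..N}}"

definition sample_vec :: "nat \<Rightarrow> (nat \<Rightarrow> nat \<Rightarrow> 'w \<Rightarrow> 'x) \<Rightarrow> nat \<Rightarrow> 'w \<Rightarrow> nat \<Rightarrow> 'x" where
  "sample_vec N \<xi> k \<omega> = (\<lambda>i\<in>{1..N}. \<xi> i k \<omega>)"

text \<open>The events determined by a draw. They are used instead of random variables because
  \<open>indep_vars\<close> needs all variables to have values in one type.\<close>

fun draw_events ::
    "'w measure \<Rightarrow> nat \<Rightarrow> (nat \<Rightarrow> 'x measure) \<Rightarrow> 'q measure \<Rightarrow> (nat \<Rightarrow> 'w \<Rightarrow> real^'d)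
     \<Rightarrow> (nat \<Rightarrow> nat \<Rightarrow> 'w \<Rightarrow> 'x) \<Rightarrow> (nat \<Rightarrow> 'w \<Rightarrow> nat set) \<Rightarrow> (nat \<Rightarrow> nat \<Rightarrow> 'w \<Rightarrow> 'q)
     \<Rightarrow> (nat \<Rightarrow> 'w \<Rightarrow> 'q) \<Rightarrow> draw \<Rightarrow> 'w set set" where
  "draw_events M N D DQ \<Phi> \<xi> S \<zeta> \<eta> (Perturb k) = sets (vimage_algebra (space M) (\<Phi> k) borel)"
| "draw_events M N D DQ \<Phi> \<xi> S \<zeta> \<eta> (Sample k) =
     sets (vimage_algebra (space M) (sample_vec N \<xi> k) (PiM {1..N} D))"
| "draw_events M N D DQ \<Phi> \<xi> S \<zeta> \<eta> (Receive k) =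
     sets (vimage_algebra (space M) (S k) (count_space (Pow {1..N})))"
| "draw_events M N D DQ \<Phi> \<xi> S \<zeta> \<eta> (DeviceSeed i k) =
     sets (vimage_algebra (space M) (\<zeta> i k) DQ)"
| "draw_events M N D DQ \<Phi> \<xi> S \<zeta> \<eta> (ServerSeed k) =
     sets (vimage_algebra (space M) (\<eta> k) DQ)"

text \<open>The sigma-algebra generated by
  \<open>\<theta>\<^sub>0, \<xi>\<^sub>0, \<theta>\<^sub>1, \<dots>, \<xi>\<^bsub>k-1\<^esub>, \<theta>\<^sub>k\<close>.\<close>

definition history ::
    "'w measure \<Rightarrow> nat \<Rightarrow> (nat \<Rightarrow> 'x measure) \<Rightarrow> (nat \<Rightarrow> 'w \<Rightarrow> real^'d)
     \<Rightarrow> (nat \<Rightarrow> nat \<Rightarrow> 'w \<Rightarrow> 'x) \<Rightarrow> nat \<Rightarrow> 'w measure" where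
  "history M N D \<theta> \<xi> k = sigma (space M)
     ((\<Union>j\<in>{..k}. sets (vimage_algebra (space M) (\<theta> j) borel)) \<union>
      (\<Union>j\<in>{..<k}. sets (vimage_algebra (space M) (sample_vec N \<xi> j) (PiM {1..N} D))))"

end

(* The expected value of g_k given theta_k is computed by conditioning on the draws of iteration k one
   at a time, from the last to the first: unbiasedness removes the server quantizer and then the device
   quantizers; exchangeability of the devices in S_k turns the weights N/|S_k| into the probability q
   that some packet arrives; integrating out the samples leaves q (F(theta_k + gamma_k Phi_k) -
   F(theta_k - gamma_k Phi_k)); and by Taylor expansion this is 2 q gamma_k <grad F(theta_k), Phi_k> up
   to an error quadratic in gamma_k. Since E[Phi Phi^T] = alpha_2 I, the resulting bias of g_k as an
   estimator of c_1 gamma_k grad F(theta_k) is at most c_1 c_3 gamma_k^2. The same conditioning bounds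
   E|g_k|^2 by c_2 gamma_k^2, the factor q appearing because g_k vanishes when no packet arrives.
   Inserting both into the descent inequality for the L-smooth F, telescoping, and comparing the sums of
   powers with integrals gives the rate. *)

theory Submission
  imports Defs
begin

subsection \<open>Gradients and smooth functions\<close>

text \<open>No conditional expectation of \<open>g k\<close> is formed. The descent inequality needs
  only the inner product of \<open>g k\<close> with the gradient at \<open>\<theta> k\<close>, that
  is, \<open>align k\<close> times a quantized number, so every stage is an identity of plain
  expectations: what has been drawn so far is frozen, and one fresh draw is integrated out by Fubini
  against its law. Only the first two moments of \<open>Q\<close> are controlled, so a quantizer can
  be removed only while its argument is frozen; this fixes the order of the stages. Each stage must
  be preceded by integrability, and all of it comes from second moments. The two query points differ
  by an almost surely bounded vector, which controls \<open>\<Delta>f\<close> whatever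
  \<open>\<theta> k\<close> is; hence \<open>g k\<close> and then \<open>\<theta> k\<close> are
  square integrable, and smoothness around the minimizer passes this on to the gradient and the
  objective. The leading part of the cross term is twice the amount wanted. Half of it pays for the
  Taylor error through 2ab \<le> a^2 + b^2, which is why \<open>c\<^sub>1 / 2\<close> and not
  \<open>c\<^sub>1\<close> multiplies the telescoped sum.\<close>

lemma GDERIV_unique:
  assumes "GDERIV h x :> D" and "GDERIV h x :> D'"
  shows "D = D'"
proof -
  have "(\<lambda>v. v \<bullet> D) = (\<lambda>v. v \<bullet> D')"
    using assms unfolding gderiv_def by (rule has_derivative_unique)
  then have "\<forall>v. v \<bullet> D = v \<bullet> D'" by meson
  then show ?thesis by (simp only: vector_eq_ldot)
qed

lemma grad_eqI: "GDERIV h x :> D \<Longrightarrow> grad h x = D"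
  unfolding grad_def by (blast intro: GDERIV_unique)

text \<open>\<open>grad\<close> is a definite description, so it is usable only where a gradient
  exists. Existence is the Riesz representation of the derivative, written out on the basis.\<close>

lemma GDERIV_grad:
  assumes "h differentiable (at x)"
  shows "GDERIV h x :> grad h x"
proof -
  from assms obtain h' where h': "(h has_derivative h') (at x)"
    by (auto simp: differentiable_def)
  then interpret bounded_linear h' by (rule has_derivative_bounded_linear)
  have "h' v = v \<bullet> (\<Sum>b\<in>Basis. h' b *\<^sub>R b)" for v
  proof -
    have "h' v = h' (\<Sum>b\<in>Basis. (v \<bullet> b) *\<^sub>R b)" by (simp add: euclidean_representation)
    also have "\<dots> = v \<bullet> (\<Sum>b\<in>Basis. h' b *\<^sub>R b)"
      by (simp add: sum scaleR inner_sum_right mult.commute)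
    finally show ?thesis .
  qed
  then have "h' = (\<lambda>v. v \<bullet> (\<Sum>b\<in>Basis. h' b *\<^sub>R b))" by blast
  then have "GDERIV h x :> (\<Sum>b\<in>Basis. h' b *\<^sub>R b)"
    unfolding gderiv_def using h' by simp
  then show ?thesis using grad_eqI by metis
qed

lemma GDERIV_sum:
  assumes "\<And>i. i \<in> I \<Longrightarrow> GDERIV (h i) x :> D i"
  shows "GDERIV (\<lambda>x. \<Sum>i\<in>I. h i x) x :> (\<Sum>i\<in>I. D i)"
  using assms unfolding gderiv_def inner_sum_right by (intro has_derivative_sum)

text \<open>On the segment from \<open>t\<close> to \<open>t + u\<close> the slope exceeds its
  initial value by at most C s |u|^2. A monotonicity argument replaces the integration of this
  bound.\<close>

lemma smooth_upper:
  fixes h :: "'a::real_inner \<Rightarrow> real"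
  assumes G: "\<And>x. GDERIV h x :> G x" and Lip: "\<And>x y. norm (G x - G y) \<le> C * norm (x - y)"
  shows "h (t + u) \<le> h t + u \<bullet> G t + C / 2 * (norm u)\<^sup>2"
proof -
  \<comment> \<open>Chosen so that \<open>\<psi> 1 \<le> \<psi> 0\<close> is the claim;
    \<open>\<psi>'\<close> is its derivative.\<close>
  define \<psi> where "\<psi> s = h (t + s *\<^sub>R u) - s * (u \<bullet> G t) - C / 2 * s\<^sup>2 * (norm u)\<^sup>2" for s :: real
  define \<psi>' where "\<psi>' s = u \<bullet> G (t + s *\<^sub>R u) - u \<bullet> G t - C * s * (norm u)\<^sup>2" for s :: real
  have "(\<psi> has_real_derivative \<psi>' s) (at s)" for s
  proof -
    have "((\<lambda>s. h (t + s *\<^sub>R u)) has_derivative (\<lambda>r. (r *\<^sub>R u) \<bullet> G (t + s *\<^sub>R u))) (at s)"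
      using G[of "t + s *\<^sub>R u"] unfolding gderiv_def
      by (rule has_derivative_compose[rotated]) (auto intro!: derivative_eq_intros)
    then have "((\<lambda>s. h (t + s *\<^sub>R u)) has_real_derivative u \<bullet> G (t + s *\<^sub>R u)) (at s)"
      unfolding has_field_derivative_def by (simp add: mult.commute[of _ "u \<bullet> _"])
    then show ?thesis unfolding \<psi>_def \<psi>'_def
      by (auto intro!: derivative_eq_intros)
  qed
  moreover have "\<psi>' s \<le> 0" if "0 \<le> s" for s
  proof -
    have "u \<bullet> G (t + s *\<^sub>R u) - u \<bullet> G t \<le> norm u * norm (G (t + s *\<^sub>R u) - G t)"
      by (simp add: inner_diff_right[symmetric] norm_cauchy_schwarz)
    also have "\<dots> \<le> norm u * (C * norm (s *\<^sub>R u))"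
      using Lip[of "t + s *\<^sub>R u" t] by (intro mult_left_mono) auto
    also have "\<dots> = C * s * (norm u)\<^sup>2" using that by (simp add: power2_eq_square)
    finally show ?thesis unfolding \<psi>'_def by simp
  qed
  ultimately have "\<psi> 1 \<le> \<psi> 0"
    by (intro DERIV_nonpos_imp_nonincreasing[of 0 1 \<psi>]) auto
  then show ?thesis unfolding \<psi>_def by simp
qed

text \<open>Upper bounds for \<open>h\<close> and for its negative, at both endpoints, leave an
  error of at most C/2 |u|^2 at each endpoint; the two errors add up to the constant
  \<open>C\<close>.\<close>

lemma smooth_central_difference:
  fixes h :: "'a::real_inner \<Rightarrow> real"
  assumes G: "\<And>x. GDERIV h x :> G x" and Lip: "\<And>x y. norm (G x - G y) \<le> C * norm (x - y)"
  shows "\<bar>h (t + u) - h (t - u) - 2 * (u \<bullet> G t)\<bar> \<le> C * (norm u)\<^sup>2"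
proof -
  have G': "GDERIV (\<lambda>x. - h x) x :> - G x" for x using G by (rule GDERIV_minus)
  have Lip': "norm (- G x - - G y) \<le> C * norm (x - y)" for x y
    using Lip[of x y] by (simp add: norm_minus_commute)
  show ?thesis
    using smooth_upper[OF G Lip, of t u] smooth_upper[OF G Lip, of t "- u"]
      smooth_upper[OF G' Lip', of t u] smooth_upper[OF G' Lip', of t "- u"]
    by simp
qed

text \<open>The Hessian matrix acts as the derivative of the gradient, so its spectral norm is the
  operator norm of that derivative and the mean value inequality applies.\<close>

lemma grad_Lipschitz_if_hessian_bound:
  fixes h :: "real^'d \<Rightarrow> real"
  assumes diff: "\<And>x. grad h differentiable (at x)"
    and bound: "\<And>x. spectral_norm (hessian h x) \<le> C"
  shows "norm (grad h x - grad h y) \<le> C * norm (x - y)"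
proof (rule differentiable_bound[where S = UNIV])
  fix z
  let ?d = "frechet_derivative (grad h) (at z)"
  have "(grad h has_derivative ?d) (at z)"
    using diff by (simp add: frechet_derivative_works)
  then show "(grad h has_derivative ?d) (at z within UNIV)" by simp
  have "bounded_linear ?d" using \<open>(grad h has_derivative ?d) (at z)\<close>
    by (rule has_derivative_bounded_linear)
  then show "onorm ?d \<le> C"
    using bound[of z] by (simp add: spectral_norm_def hessian_def)
qed auto

subsection \<open>Joint measurability of functions continuous in one variable\<close>

text \<open>Joint measurability of Caratheodory functions: with \<open>t\<close> replaced by a
  nearby point of a countable dense set, the function is pieced together from countably many
  measurable ones, and continuity in \<open>t\<close> gives convergence. It makes losses at random
  query points measurable.\<close>

lemma measurable_if_continuous_fst:
  fixes h :: "'a::{metric_space, second_countable_topology} \<Rightarrow> 'x \<Rightarrow> real"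
  assumes meas: "\<And>t. h t \<in> borel_measurable N"
    and cont: "\<And>x. x \<in> space N \<Longrightarrow> continuous_on UNIV (\<lambda>t. h t x)"
  shows "(\<lambda>(t, x). h t x) \<in> borel_measurable (borel \<Otimes>\<^sub>M N)"
proof -
  obtain B :: "'a set" where B: "countable B" "\<And>X. open X \<Longrightarrow> X \<noteq> {} \<Longrightarrow> \<exists>d\<in>B. d \<in> X"
    using countable_dense_exists[where 'a='a] by blast
  define e where "e = from_nat_into B"
  have "B \<noteq> {}" using B(2)[of UNIV] by auto
  then have range_e: "range e = B" unfolding e_def using B(1) by (simp add: range_from_nat_into)
  \<comment> \<open>Taking the least admissible index, rather than an arbitrary one, makes the
    choice measurable in \<open>t\<close>.\<close>
  define m where "m n t = (LEAST j. dist (e j) t < 1 / real (Suc n))" for n t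
  have ex: "\<exists>j. dist (e j) t < 1 / real (Suc n)" for n t
  proof -
    have "t \<in> ball t (1 / real (Suc n))" by simp
    then obtain d where "d \<in> B" "d \<in> ball t (1 / real (Suc n))"
      using B(2)[of "ball t (1 / real (Suc n))"] by (metis empty_iff open_ball)
    then show ?thesis using range_e by (metis dist_commute mem_ball rangeE)
  qed
  have close: "dist (e (m n t)) t < 1 / real (Suc n)" for n t
    unfolding m_def using LeastI_ex[OF ex] .
  have "(\<lambda>n. e (m n t)) \<longlonglongrightarrow> t" for t
  proof (rule metric_tendsto_imp_tendsto)
    show "(\<lambda>n. 1 / real (Suc n)) \<longlonglongrightarrow> 0" by (rule LIMSEQ_Suc[OF lim_1_over_n])
    show "\<forall>\<^sub>F n in sequentially. dist (e (m n t)) t \<le> dist (1 / real (Suc n)) 0"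
      using close[THEN less_imp_le] by (intro always_eventually) simp
  qed
  note lim = this
  have [measurable]: "m n \<in> measurable borel (count_space UNIV)" for n
    unfolding m_def by measurable
  show ?thesis
  proof (rule borel_measurable_LIMSEQ_real[where u = "\<lambda>n (t, x). h (e (m n t)) x"])
    fix z :: "'a \<times> 'x" assume "z \<in> space (borel \<Otimes>\<^sub>M N)"
    then have "continuous_on UNIV (\<lambda>t. h t (snd z))" by (auto simp: space_pair_measure cont)
    then have "isCont (\<lambda>t. h t (snd z)) (fst z)"
      by (simp add: continuous_on_eq_continuous_at)
    then show "(\<lambda>n. case z of (t, x) \<Rightarrow> h (e (m n t)) x) \<longlonglongrightarrow> (case z of (t, x) \<Rightarrow> h t x)"
      unfolding case_prod_beta by (rule isCont_tendsto_compose[OF _ lim])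
  next
    fix n
    have "(\<lambda>z. h (e (m n (fst z))) (snd z)) \<in> borel_measurable (borel \<Otimes>\<^sub>M N)"
    proof (rule measurable_compose_countable[where f = "\<lambda>j z. h (e j) (snd z)"])
      show "(\<lambda>z. h (e j) (snd z)) \<in> borel_measurable (borel \<Otimes>\<^sub>M N)" for j
        using meas[of "e j"] by measurable
      show "(\<lambda>z. m n (fst z)) \<in> measurable (borel \<Otimes>\<^sub>M N) (count_space UNIV)"
        by measurable
    qed
    then show "(\<lambda>(t, x). h (e (m n t)) x) \<in> borel_measurable (borel \<Otimes>\<^sub>M N)"
      by (simp add: case_prod_beta)
  qed
qed

subsection \<open>Independent random variables\<close>

context prob_space
begin

text \<open>Independence is stated for sigma-algebras, so that \<open>X\<close> may bundle many
  quantities and \<open>X\<close>, \<open>Z\<close> may have values in different types. Rectangles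
  determine the joint law.\<close>

lemma
  assumes indep: "indep_set (sets A) (sets B)" and space: "space A = space M" "space B = space M"
    and X: "X \<in> measurable A S" and Z: "Z \<in> measurable B T"
  shows indep_set_measurable_fst: "X \<in> measurable M S"
    and indep_set_measurable_snd: "Z \<in> measurable M T"
    and indep_set_distr_pair:
      "distr M S X \<Otimes>\<^sub>M distr M T Z = distr M (S \<Otimes>\<^sub>M T) (\<lambda>\<omega>. (X \<omega>, Z \<omega>))"
proof -
  have sub: "sets A \<subseteq> events" "sets B \<subseteq> events"
    and prod: "\<And>a b. a \<in> sets A \<Longrightarrow> b \<in> sets B \<Longrightarrow> prob (a \<inter> b) = prob a * prob b"
    using indep unfolding indep_sets2_eq by auto
  show X'[measurable]: "X \<in> measurable M S" and Z'[measurable]: "Z \<in> measurable M T"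
    using X Z sub space unfolding measurable_def by (auto simp: subset_iff)
  interpret X: prob_space "distr M S X" using X' by (rule prob_space_distr)
  interpret Z: prob_space "distr M T Z" using Z' by (rule prob_space_distr)
  show "distr M S X \<Otimes>\<^sub>M distr M T Z = distr M (S \<Otimes>\<^sub>M T) (\<lambda>\<omega>. (X \<omega>, Z \<omega>))"
  proof (rule pair_measure_eqI)
    show "sigma_finite_measure (distr M S X)" "sigma_finite_measure (distr M T Z)" ..
    show "sets (distr M S X \<Otimes>\<^sub>M distr M T Z) = sets (distr M (S \<Otimes>\<^sub>M T) (\<lambda>\<omega>. (X \<omega>, Z \<omega>)))"
      by (simp cong: sets_pair_measure_cong)
    fix a b assume "a \<in> sets (distr M S X)" "b \<in> sets (distr M T Z)"
    then have [measurable]: "a \<in> sets S" "b \<in> sets T" by auto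
    have "prob ((X -` a \<inter> space M) \<inter> (Z -` b \<inter> space M))
        = prob (X -` a \<inter> space M) * prob (Z -` b \<inter> space M)"
      using measurable_sets[OF X, of a] measurable_sets[OF Z, of b] space
      by (intro prod) auto
    moreover have "(\<lambda>\<omega>. (X \<omega>, Z \<omega>)) -` (a \<times> b) \<inter> space M
        = (X -` a \<inter> space M) \<inter> (Z -` b \<inter> space M)" by auto
    ultimately show "emeasure (distr M S X) a * emeasure (distr M T Z) b
        = emeasure (distr M (S \<Otimes>\<^sub>M T) (\<lambda>\<omega>. (X \<omega>, Z \<omega>))) (a \<times> b)"
      by (simp add: emeasure_distr emeasure_eq_measure ennreal_mult')
  qed
qed

text \<open>Freezing \<open>X\<close> and integrating out the independent \<open>Z\<close>. This
  nonnegative version can be used before anything is known to be integrable; the real version below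
  presupposes integrability.\<close>

lemma indep_set_nn_integral_eq:
  assumes indep: "indep_set (sets A) (sets B)" and space: "space A = space M" "space B = space M"
    and XA: "X \<in> measurable A S" and ZB: "Z \<in> measurable B T"
    and h[measurable]: "h \<in> borel_measurable (S \<Otimes>\<^sub>M T)"
  shows "(\<integral>\<^sup>+\<omega>. h (X \<omega>, Z \<omega>) \<partial>M) = (\<integral>\<^sup>+\<omega>. (\<integral>\<^sup>+z. h (X \<omega>, z) \<partial>distr M T Z) \<partial>M)"
proof -
  note [measurable] = indep_set_measurable_fst[OF indep space XA ZB]
    indep_set_measurable_snd[OF indep space XA ZB]
  note eq = indep_set_distr_pair[OF indep space XA ZB]
  interpret Z: prob_space "distr M T Z" by (rule prob_space_distr) simp
  have m: "(\<lambda>x. \<integral>\<^sup>+z. h (x, z) \<partial>distr M T Z) \<in> borel_measurable S"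
    by (rule Z.borel_measurable_nn_integral)
       (simp add: case_prod_beta cong: measurable_cong_sets)
  have "(\<integral>\<^sup>+\<omega>. h (X \<omega>, Z \<omega>) \<partial>M) = (\<integral>\<^sup>+y. h y \<partial>(distr M S X \<Otimes>\<^sub>M distr M T Z))"
    unfolding eq by (subst nn_integral_distr) auto
  also have "\<dots> = (\<integral>\<^sup>+x. (\<integral>\<^sup>+z. h (x, z) \<partial>distr M T Z) \<partial>distr M S X)"
    by (rule Z.nn_integral_fst[symmetric]) (simp cong: measurable_cong_sets)
  also have "\<dots> = (\<integral>\<^sup>+\<omega>. (\<integral>\<^sup>+z. h (X \<omega>, z) \<partial>distr M T Z) \<partial>M)"
    using m by (subst nn_integral_distr) auto
  finally show ?thesis .
qed

lemma
  fixes h :: "'b \<times> 'c \<Rightarrow> real"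
  assumes indep: "indep_set (sets A) (sets B)" and space: "space A = space M" "space B = space M"
    and XA: "X \<in> measurable A S" and ZB: "Z \<in> measurable B T"
    and h[measurable]: "h \<in> borel_measurable (S \<Otimes>\<^sub>M T)"
    and int: "integrable M (\<lambda>\<omega>. h (X \<omega>, Z \<omega>))"
  shows indep_set_integrable_fst: "integrable M (\<lambda>\<omega>. \<integral>z. h (X \<omega>, z) \<partial>distr M T Z)"
    and indep_set_integral_eq: "(\<integral>\<omega>. h (X \<omega>, Z \<omega>) \<partial>M) = (\<integral>\<omega>. (\<integral>z. h (X \<omega>, z) \<partial>distr M T Z) \<partial>M)"
proof -
  note [measurable] = indep_set_measurable_fst[OF indep space XA ZB]
    indep_set_measurable_snd[OF indep space XA ZB]
  note eq = indep_set_distr_pair[OF indep space XA ZB]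
  interpret X: prob_space "distr M S X" by (rule prob_space_distr) simp
  interpret Z: prob_space "distr M T Z" by (rule prob_space_distr) simp
  interpret P: pair_prob_space "distr M S X" "distr M T Z" ..
  have int': "integrable (distr M S X \<Otimes>\<^sub>M distr M T Z) h"
    unfolding eq using int by (subst integrable_distr_eq) auto
  note Fub = P.integral_fst'[OF int']
  have m: "(\<lambda>x. \<integral>z. h (x, z) \<partial>distr M T Z) \<in> borel_measurable S"
    by (rule Z.borel_measurable_lebesgue_integral)
       (simp add: case_prod_beta cong: measurable_cong_sets)
  show "integrable M (\<lambda>\<omega>. \<integral>z. h (X \<omega>, z) \<partial>distr M T Z)"
    using P.integrable_fst'[OF int'] m by (subst (asm) integrable_distr_eq) auto
  have "(\<integral>\<omega>. h (X \<omega>, Z \<omega>) \<partial>M) = (\<integral>y. h y \<partial>distr M (S \<Otimes>\<^sub>M T) (\<lambda>\<omega>. (X \<omega>, Z \<omega>)))"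
    by (subst integral_distr) auto
  also have "\<dots> = (\<integral>x. (\<integral>z. h (x, z) \<partial>distr M T Z) \<partial>distr M S X)"
    unfolding eq[symmetric] Fub ..
  also have "\<dots> = (\<integral>\<omega>. (\<integral>z. h (X \<omega>, z) \<partial>distr M T Z) \<partial>M)"
    using m by (subst integral_distr) auto
  finally show "(\<integral>\<omega>. h (X \<omega>, Z \<omega>) \<partial>M) = (\<integral>\<omega>. (\<integral>z. h (X \<omega>, z) \<partial>distr M T Z) \<partial>M)" .
qed

lemma indep_set_integral_mult:
  fixes X Z :: "'a \<Rightarrow> real"
  assumes indep: "indep_set (sets A) (sets B)" and space: "space A = space M" "space B = space M"
    and X: "X \<in> borel_measurable A" and Z: "Z \<in> borel_measurable B"
    and int: "integrable M X" "integrable M Z"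
  shows "integrable M (\<lambda>\<omega>. X \<omega> * Z \<omega>)"
    and "(\<integral>\<omega>. X \<omega> * Z \<omega> \<partial>M) = (\<integral>\<omega>. X \<omega> \<partial>M) * (\<integral>\<omega>. Z \<omega> \<partial>M)"
proof -
  have "indep_var borel X borel Z"
    unfolding indep_var_distribution_eq
    using indep_set_measurable_fst[OF indep space X Z] indep_set_measurable_snd[OF indep space X Z]
      indep_set_distr_pair[OF indep space X Z] by simp
  then show "integrable M (\<lambda>\<omega>. X \<omega> * Z \<omega>)"
    and "(\<integral>\<omega>. X \<omega> * Z \<omega> \<partial>M) = (\<integral>\<omega>. X \<omega> \<partial>M) * (\<integral>\<omega>. Z \<omega> \<partial>M)"
    using int by (auto intro: indep_var_integrable indep_var_lebesgue_integral)
qed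

lemma integrable_mult_square_integrable:
  fixes X Y :: "'a \<Rightarrow> real"
  assumes [measurable]: "X \<in> borel_measurable M" "Y \<in> borel_measurable M"
    and "integrable M (\<lambda>\<omega>. (X \<omega>)\<^sup>2)" "integrable M (\<lambda>\<omega>. (Y \<omega>)\<^sup>2)"
  shows "integrable M (\<lambda>\<omega>. X \<omega> * Y \<omega>)"
proof (rule Bochner_Integration.integrable_bound)
  show "integrable M (\<lambda>\<omega>. (X \<omega>)\<^sup>2 + (Y \<omega>)\<^sup>2)" using assms by auto
  have "\<bar>x * y\<bar> \<le> x\<^sup>2 + y\<^sup>2" for x y :: real
  proof -
    have "\<bar>x * y\<bar> \<le> 2 * (\<bar>x\<bar> * \<bar>y\<bar>)" by (simp add: abs_mult)
    also have "\<dots> \<le> x\<^sup>2 + y\<^sup>2" using sum_squares_bound[of "\<bar>x\<bar>" "\<bar>y\<bar>"] by (simp add: mult.assoc)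
    finally show ?thesis .
  qed
  then show "AE \<omega> in M. norm (X \<omega> * Y \<omega>) \<le> norm ((X \<omega>)\<^sup>2 + (Y \<omega>)\<^sup>2)"
    by (intro AE_I2) simp
qed simp

lemma integral_finite_valued:
  fixes h :: "'b \<Rightarrow> real"
  assumes "finite R" and X[measurable]: "X \<in> measurable M (count_space R)"
  shows "integrable M (\<lambda>\<omega>. h (X \<omega>))"
    and "(\<integral>\<omega>. h (X \<omega>) \<partial>M) = (\<Sum>a\<in>R. h a * prob {\<omega> \<in> space M. X \<omega> = a})"
proof -
  have int: "integrable M (\<lambda>\<omega>. \<Sum>a\<in>R. h a * indicat_real {\<omega> \<in> space M. X \<omega> = a} \<omega>)"
    by (intro Bochner_Integration.integrable_sum integrable_mult_right) (auto simp: less_top[symmetric])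
  have eq: "(\<Sum>a\<in>R. h a * indicat_real {\<omega> \<in> space M. X \<omega> = a} \<omega>) = h (X \<omega>)"
    if "\<omega> \<in> space M" for \<omega>
  proof -
    have "X \<omega> \<in> R" using measurable_space[OF X that] by simp
    then show ?thesis
      using that \<open>finite R\<close> by (simp add: indicator_def of_bool_def if_distrib[of "(*) _"] sum.delta' cong: if_cong)
  qed
  show "integrable M (\<lambda>\<omega>. h (X \<omega>))"
    by (rule Bochner_Integration.integrable_cong[THEN iffD1, rotated 2, OF int]) (simp_all add: eq)
  have "(\<integral>\<omega>. h (X \<omega>) \<partial>M) = (\<integral>\<omega>. (\<Sum>a\<in>R. h a * indicat_real {\<omega> \<in> space M. X \<omega> = a} \<omega>) \<partial>M)"
    using eq by (intro Bochner_Integration.integral_cong) auto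
  also have "\<dots> = (\<Sum>a\<in>R. h a * prob {\<omega> \<in> space M. X \<omega> = a})"
    by (subst Bochner_Integration.integral_sum)
       (auto intro!: integrable_mult_right sum.cong simp: less_top[symmetric])
  finally show "(\<integral>\<omega>. h (X \<omega>) \<partial>M) = (\<Sum>a\<in>R. h a * prob {\<omega> \<in> space M. X \<omega> = a})" .
qed

end

subsection \<open>Packet reception\<close>

text \<open>The coefficient of device \<open>i\<close> in the server average. With it the average is
  a sum over all devices, reception enters as a bounded factor, and the empty set needs no separate
  case.\<close>

definition weight :: "nat \<Rightarrow> nat \<Rightarrow> nat set \<Rightarrow> real" where
  "weight N i A = (if i \<in> A then real N / real (card A) else 0)"

lemma weight_nonneg: "0 \<le> weight N i A"
  by (simp add: weight_def)

lemma weight_le: 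
  assumes "A \<subseteq> {1..N}" shows "weight N i A \<le> real N"
proof (cases "i \<in> A")
  case True
  then have "card A \<ge> 1" using assms finite_subset[OF assms] by (auto simp: Suc_le_eq card_gt_0_iff)
  then have "real N / real (card A) \<le> real N / 1" by (intro divide_left_mono) auto
  then show ?thesis by (simp add: weight_def)
qed (simp add: weight_def)

lemma server_average_eq_weight:
  assumes "A \<subseteq> {1..N}"
  shows "server_average N A y = (\<Sum>i\<in>{1..N}. weight N i A * y i)"
proof -
  have "(\<Sum>i\<in>{1..N}. weight N i A * y i) = (\<Sum>i\<in>A. real N / real (card A) * y i)"
    using assms by (intro sum.mono_neutral_cong_right) (auto simp: weight_def)
  also have "\<dots> = server_average N A y"
    by (simp add: server_average_def sum_distrib_left)
  finally show ?thesis ..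
qed

text \<open>Cauchy-Schwarz over the received devices. The weight stays to the first power on the
  right, so that its expectation later produces the single factor q of
  \<open>c\<^sub>2\<close>.\<close>

lemma server_average_square_le:
  assumes "A \<subseteq> {1..N}"
  shows "(server_average N A y)\<^sup>2 \<le> real N * (\<Sum>i\<in>{1..N}. weight N i A * (y i)\<^sup>2)"
proof (cases "card A = 0")
  case True
  then show ?thesis by (simp add: server_average_def sum_nonneg weight_nonneg)
next
  case False
  have "(server_average N A y)\<^sup>2 = (real N / real (card A))\<^sup>2 * (\<Sum>i\<in>A. y i)\<^sup>2"
    using False by (simp add: server_average_def power_mult_distrib power_divide)
  also have "\<dots> \<le> (real N / real (card A))\<^sup>2 * ((\<Sum>i\<in>A. (y i)\<^sup>2) * card A)"
    by (intro mult_left_mono sum_squared_le_sum_of_squares) auto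
  also have "\<dots> = real N * server_average N A (\<lambda>i. (y i)\<^sup>2)"
    using False by (simp add: server_average_def power2_eq_square)
  finally show ?thesis using server_average_eq_weight[OF assms] by simp
qed

lemma sum_weight:
  assumes "A \<subseteq> {1..N}"
  shows "(\<Sum>i\<in>{1..N}. weight N i A) = (if A = {} then 0 else real N)"
proof -
  have "(\<Sum>i\<in>{1..N}. weight N i A) = server_average N A (\<lambda>_. 1)"
    using server_average_eq_weight[OF assms, of "\<lambda>_. 1"] by simp
  also have "\<dots> = (if A = {} then 0 else real N)"
    using finite_subset[OF assms] by (auto simp: server_average_def)
  finally show ?thesis .
qed

text \<open>Swapping \<open>i\<close> and \<open>j\<close> is an involution of the subsets that
  keeps cardinalities. The factor \<open>h (card A)\<close> stands for the probability of
  \<open>A\<close>, which depends on its cardinality only.\<close>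

lemma sum_weight_exchangeable:
  assumes "i \<in> {1..N}" "j \<in> {1..N}"
  shows "(\<Sum>A\<in>Pow {1..N}. weight N i A * h (card A)) = (\<Sum>A\<in>Pow {1..N}. weight N j A * h (card A))"
proof -
  let ?t = "Transposition.transpose i j"
  have [simp]: "?t ` ?t ` A = A" for A by (simp add: image_image)
  have card_t [simp]: "card (?t ` A) = card A" for A
    by (rule card_image) simp
  have mem: "j \<in> ?t ` A \<longleftrightarrow> i \<in> A" for A by (auto simp: Transposition.transpose_def)
  have sub: "?t ` A \<subseteq> {1..N}" if "A \<subseteq> {1..N}" for A
    using that assms by (auto simp: Transposition.transpose_def)
  show ?thesis
    by (rule sum.reindex_bij_witness[where i = "image ?t" and j = "image ?t"])
       (use sub mem in \<open>auto simp: weight_def\<close>)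
qed

context prob_space
begin

lemma prob_received_set:
  fixes R :: "'a \<Rightarrow> nat set"
  assumes R: "R \<in> measurable M (count_space (Pow {1..N}))"
    and prob: "\<And>i. i \<in> {1..N} \<Longrightarrow> prob {\<omega> \<in> space M. i \<in> R \<omega>} = p"
    and indep: "indep_events (\<lambda>i. {\<omega> \<in> space M. i \<in> R \<omega>}) {1..N}"
    and "N \<ge> 1" and A: "A \<subseteq> {1..N}"
  shows "prob {\<omega> \<in> space M. R \<omega> = A} = p ^ card A * (1 - p) ^ (N - card A)"
proof -
  let ?E = "\<lambda>i. {\<omega> \<in> space M. i \<in> R \<omega>}"
  let ?B = "\<lambda>i. if i \<in> A then ?E i else space M - ?E i"
  have ev: "?E i \<in> events" if "i \<in> {1..N}" for i
    using indep that unfolding indep_events_def by auto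
  \<comment> \<open>Independence is lifted to the generated sigma-algebras because the intersection
    below mixes the events with complements.\<close>
  have "indep_sets (\<lambda>i. sigma_sets (space M) {?E i}) {1..N}"
    using indep unfolding indep_events_def_alt
    by (intro indep_sets_sigma) (auto simp: Int_stable_def)
  then have "prob (\<Inter>i\<in>{1..N}. ?B i) = (\<Prod>i\<in>{1..N}. prob (?B i))"
    using \<open>N \<ge> 1\<close> by (intro indep_setsD) (auto intro: sigma_sets.Basic sigma_sets.Compl)
  also have "\<dots> = (\<Prod>i\<in>{1..N}. if i \<in> A then p else 1 - p)"
    by (intro prod.cong) (auto simp: prob prob_compl[OF ev])
  also have "\<dots> = p ^ card A * (1 - p) ^ (N - card A)"
  proof -
    have "{1..N} \<inter> {i. i \<in> A} = A" "{1..N} \<inter> - {i. i \<in> A} = {1..N} - A" using A by auto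
    moreover have "card ({1..N} - A) = N - card A"
      using A finite_subset[OF A] by (simp add: card_Diff_subset)
    ultimately show ?thesis by (simp add: prod.If_cases)
  qed
  also have "(\<Inter>i\<in>{1..N}. ?B i) = {\<omega> \<in> space M. R \<omega> = A}"
  proof (intro equalityI subsetI)
    fix \<omega> assume \<omega>: "\<omega> \<in> (\<Inter>i\<in>{1..N}. ?B i)"
    \<comment> \<open>An intersection over no devices would be the whole type; one device is needed
      to place \<omega> in the sample space.\<close>
    then have "\<omega> \<in> ?B 1" using \<open>N \<ge> 1\<close> by auto
    then have "\<omega> \<in> space M" by (auto split: if_splits)
    moreover have "R \<omega> = A"
    proof -
      have "R \<omega> \<subseteq> {1..N}" using measurable_space[OF R \<open>\<omega> \<in> space M\<close>] by simp
      moreover have "i \<in> R \<omega> \<longleftrightarrow> i \<in> A" if "i \<in> {1..N}" for i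
      proof -
        have "\<omega> \<in> ?B i" using \<omega> that by (rule INT_D)
        then show ?thesis by (cases "i \<in> A") auto
      qed
      ultimately show ?thesis using A by blast
    qed
    ultimately show "\<omega> \<in> {\<omega> \<in> space M. R \<omega> = A}" by simp
  qed auto
  finally show ?thesis .
qed

text \<open>The mean of N/|S| on the event that \<open>i\<close> is received is never computed. By
  symmetry it is the same for all devices, and the N equal values add up to N times the probability
  that some packet arrives.\<close>

lemma expectation_weight:
  fixes R :: "'a \<Rightarrow> nat set"
  assumes R: "R \<in> measurable M (count_space (Pow {1..N}))"
    and prob: "\<And>i. i \<in> {1..N} \<Longrightarrow> prob {\<omega> \<in> space M. i \<in> R \<omega>} = p"
    and indep: "indep_events (\<lambda>i. {\<omega> \<in> space M. i \<in> R \<omega>}) {1..N}"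
    and i: "i \<in> {1..N}"
  shows "expectation (\<lambda>\<omega>. weight N i (R \<omega>)) = 1 - (1 - p) ^ N"
proof -
  from i have "N \<ge> 1" by simp
  let ?P = "\<lambda>c. p ^ c * (1 - p) ^ (N - c)"
  have int: "integrable M (\<lambda>\<omega>. weight N j (R \<omega>))" for j
    using R by (intro integral_finite_valued(1)[where R = "Pow {1..N}"]) auto
  have eq: "expectation (\<lambda>\<omega>. h (R \<omega>)) = (\<Sum>A\<in>Pow {1..N}. h A * ?P (card A))" for h
  proof -
    have "expectation (\<lambda>\<omega>. h (R \<omega>)) = (\<Sum>A\<in>Pow {1..N}. h A * prob {\<omega> \<in> space M. R \<omega> = A})"
      by (rule integral_finite_valued(2)[OF _ R]) simp
    also have "\<dots> = (\<Sum>A\<in>Pow {1..N}. h A * ?P (card A))"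
      by (rule sum.cong[OF refl]) (simp only: prob_received_set[OF R prob indep \<open>N \<ge> 1\<close>] Pow_iff)
    finally show ?thesis .
  qed
  have "real N * expectation (\<lambda>\<omega>. weight N i (R \<omega>)) = (\<Sum>j\<in>{1..N}. expectation (\<lambda>\<omega>. weight N i (R \<omega>)))"
    by simp
  also have "\<dots> = (\<Sum>j\<in>{1..N}. expectation (\<lambda>\<omega>. weight N j (R \<omega>)))"
  proof (intro sum.cong refl)
    fix j assume "j \<in> {1..N}"
    then show "expectation (\<lambda>\<omega>. weight N i (R \<omega>)) = expectation (\<lambda>\<omega>. weight N j (R \<omega>))"
      unfolding eq[of "weight N i"] eq[of "weight N j"]
      using sum_weight_exchangeable[OF i, of j ?P] by simp
  qed
  also have "\<dots> = expectation (\<lambda>\<omega>. \<Sum>j\<in>{1..N}. weight N j (R \<omega>))"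
    using int by (subst Bochner_Integration.integral_sum) auto
  also have "\<dots> = expectation (\<lambda>\<omega>. if R \<omega> = {} then 0 else real N)"
    using measurable_space[OF R]
    by (intro Bochner_Integration.integral_cong[OF refl] sum_weight) simp
  also have "\<dots> = expectation (\<lambda>\<omega>. real N * (1 - indicator {{}} (R \<omega>)))"
    by (intro Bochner_Integration.integral_cong) (auto simp: indicator_def)
  also have "\<dots> = real N * (1 - expectation (\<lambda>\<omega>. indicator {{}} (R \<omega>)))"
    using integral_finite_valued(1)[OF _ R, of "indicator {{}}"]
    by (simp add: Bochner_Integration.integral_diff prob_space)
  \<comment> \<open>Only the empty set contributes to the sum, with cardinality 0.\<close>
  also have "expectation (\<lambda>\<omega>. indicator {{}} (R \<omega>)) = (\<Sum>A\<in>{{} :: nat set}. ?P (card A))"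
    unfolding eq[of "indicator {{}}"] by (intro sum.mono_neutral_cong_right) (auto simp: indicator_def)
  also have "\<dots> = (1 - p) ^ N" by simp
  finally show ?thesis using \<open>N \<ge> 1\<close> by simp
qed

end

subsection \<open>Quantization\<close>

lemma unbiased_quantizer_measurable:
  assumes "unbiased_quantizer DQ Q \<sigma>" and "s \<in> measurable K DQ" and "x \<in> borel_measurable K"
  shows "(\<lambda>\<omega>. Q (s \<omega>) (x \<omega>)) \<in> borel_measurable K"
proof -
  have "(\<lambda>\<omega>. (s \<omega>, x \<omega>)) \<in> measurable K (DQ \<Otimes>\<^sub>M borel)"
    using assms(2,3) by (rule measurable_Pair)
  moreover have "(\<lambda>(s, x). Q s x) \<in> borel_measurable (DQ \<Otimes>\<^sub>M borel)"
    using assms(1) by (simp add: unbiased_quantizer_def)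
  ultimately have "(\<lambda>\<omega>. case (s \<omega>, x \<omega>) of (s, x) \<Rightarrow> Q s x) \<in> borel_measurable K"
    by (rule measurable_compose)
  then show ?thesis by simp
qed

text \<open>The second moment is the variance plus the squared mean: at most \<sigma> x^2 plus
  x^2.\<close>

lemma unbiased_quantizer_second_moment:
  assumes "unbiased_quantizer DQ Q \<sigma>"
  shows "(\<integral>\<^sup>+s. ennreal ((Q s x)\<^sup>2) \<partial>DQ) \<le> ennreal ((\<sigma> + 1) * x\<^sup>2)"
proof -
  interpret prob_space DQ using assms by (simp add: unbiased_quantizer_def)
  have int: "integrable DQ (\<lambda>s. Q s x)" and mean: "(\<integral>s. Q s x \<partial>DQ) = x"
    and int2: "integrable DQ (\<lambda>s. (Q s x - x)\<^sup>2)" and var: "(\<integral>s. (Q s x - x)\<^sup>2 \<partial>DQ) \<le> \<sigma> * x\<^sup>2"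
    using assms by (auto simp: unbiased_quantizer_def)
  have eq: "(Q s x)\<^sup>2 = (Q s x - x)\<^sup>2 + (2 * x * Q s x - x\<^sup>2)" for s
    by (simp add: power2_eq_square algebra_simps)
  have int3: "integrable DQ (\<lambda>s. 2 * x * Q s x - x\<^sup>2)" using int by auto
  have "integrable DQ (\<lambda>s. (Q s x)\<^sup>2)"
    unfolding eq using int2 int3 by (rule Bochner_Integration.integrable_add)
  then have "(\<integral>\<^sup>+s. ennreal ((Q s x)\<^sup>2) \<partial>DQ) = ennreal (\<integral>s. (Q s x)\<^sup>2 \<partial>DQ)"
    by (intro nn_integral_eq_integral) auto
  also have "(\<integral>s. (Q s x)\<^sup>2 \<partial>DQ) = (\<integral>s. (Q s x - x)\<^sup>2 \<partial>DQ) + (2 * x * x - x\<^sup>2)"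
    unfolding eq Bochner_Integration.integral_add[OF int2 int3] using int mean
    by (simp add: prob_space)
  also have "\<dots> \<le> (\<sigma> + 1) * x\<^sup>2" using var by (simp add: power2_eq_square algebra_simps)
  finally show ?thesis by (simp add: ennreal_leI)
qed

text \<open>\<open>Z\<close> is a fresh seed, and all else in the integrand is known to
  \<open>A\<close>. The factor \<open>W\<close> allows a quantizer to be removed inside a larger
  product: it will be 1, a reception weight, or \<open>align\<close>, alone or times a
  weight.\<close>

lemma (in prob_space)
  assumes quant: "unbiased_quantizer DQ Q \<sigma>"
    and indep: "indep_set (sets A) (sets B)" and space: "space A = space M" "space B = space M"
    and W: "W \<in> borel_measurable A" and Y: "Y \<in> borel_measurable A"
    and Z: "Z \<in> measurable B DQ" and law: "distr M DQ Z = DQ"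
  shows expectation_quantized:
      "integrable M (\<lambda>\<omega>. W \<omega> * Q (Z \<omega>) (Y \<omega>)) \<Longrightarrow>
       expectation (\<lambda>\<omega>. W \<omega> * Q (Z \<omega>) (Y \<omega>)) = expectation (\<lambda>\<omega>. W \<omega> * Y \<omega>)"
    and integrable_quantized_square:
      "(\<And>\<omega>. \<omega> \<in> space M \<Longrightarrow> 0 \<le> W \<omega>) \<Longrightarrow> integrable M (\<lambda>\<omega>. W \<omega> * (Y \<omega>)\<^sup>2) \<Longrightarrow>
       integrable M (\<lambda>\<omega>. W \<omega> * (Q (Z \<omega>) (Y \<omega>))\<^sup>2)"
    and expectation_quantized_square_le:
      "(\<And>\<omega>. \<omega> \<in> space M \<Longrightarrow> 0 \<le> W \<omega>) \<Longrightarrow> integrable M (\<lambda>\<omega>. W \<omega> * (Y \<omega>)\<^sup>2) \<Longrightarrow>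
       expectation (\<lambda>\<omega>. W \<omega> * (Q (Z \<omega>) (Y \<omega>))\<^sup>2) \<le> (\<sigma> + 1) * expectation (\<lambda>\<omega>. W \<omega> * (Y \<omega>)\<^sup>2)"
    and quantized_measurable: "(\<lambda>\<omega>. Q (Z \<omega>) (Y \<omega>)) \<in> borel_measurable M"
proof -
  interpret Q: prob_space DQ using quant by (simp add: unbiased_quantizer_def)
  have Q_mean: "\<And>x. (\<integral>s. Q s x \<partial>DQ) = x"
    using quant by (auto simp: unbiased_quantizer_def)
  have XA: "(\<lambda>\<omega>. (W \<omega>, Y \<omega>)) \<in> measurable A (borel \<Otimes>\<^sub>M borel)"
    using W Y by measurable
  have W_M[measurable]: "W \<in> borel_measurable M" and Y_M[measurable]: "Y \<in> borel_measurable M"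
    and Z_M[measurable]: "Z \<in> measurable M DQ"
    using indep_set_measurable_fst[OF indep space W Z] indep_set_measurable_fst[OF indep space Y Z]
    indep_set_measurable_snd[OF indep space Y Z] by blast+
  note Qc = unbiased_quantizer_measurable[OF quant]
  show QM[measurable]: "(\<lambda>\<omega>. Q (Z \<omega>) (Y \<omega>)) \<in> borel_measurable M"
    using Z_M Y_M by (rule Qc)
  have [measurable]: "(\<lambda>y. Q (snd y) (snd (fst y))) \<in> borel_measurable ((borel \<Otimes>\<^sub>M borel) \<Otimes>\<^sub>M DQ)"
    by (rule Qc) measurable
  show "expectation (\<lambda>\<omega>. W \<omega> * Q (Z \<omega>) (Y \<omega>)) = expectation (\<lambda>\<omega>. W \<omega> * Y \<omega>)"
    if "integrable M (\<lambda>\<omega>. W \<omega> * Q (Z \<omega>) (Y \<omega>))"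
    using indep_set_integral_eq[OF indep space XA Z, of "\<lambda>y. fst (fst y) * Q (snd y) (snd (fst y))"] that
    by (simp add: law Q_mean)
  assume W_nonneg: "\<And>\<omega>. \<omega> \<in> space M \<Longrightarrow> 0 \<le> W \<omega>" and int: "integrable M (\<lambda>\<omega>. W \<omega> * (Y \<omega>)\<^sup>2)"
  have "(\<integral>\<^sup>+\<omega>. ennreal (W \<omega> * (Q (Z \<omega>) (Y \<omega>))\<^sup>2) \<partial>M)
      = (\<integral>\<^sup>+\<omega>. \<integral>\<^sup>+s. ennreal (W \<omega> * (Q s (Y \<omega>))\<^sup>2) \<partial>DQ \<partial>M)"
    using indep_set_nn_integral_eq[OF indep space XA Z,
        of "\<lambda>y. ennreal (fst (fst y) * (Q (snd y) (snd (fst y)))\<^sup>2)"]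
    by (simp add: law)
  also have "\<dots> \<le> (\<integral>\<^sup>+\<omega>. ennreal ((\<sigma> + 1) * (W \<omega> * (Y \<omega>)\<^sup>2)) \<partial>M)"
  proof (intro nn_integral_mono)
    fix \<omega> assume "\<omega> \<in> space M"
    have m: "(\<lambda>s. Q s (Y \<omega>)) \<in> borel_measurable DQ" by (rule Qc) auto
    then have "(\<integral>\<^sup>+s. ennreal (W \<omega> * (Q s (Y \<omega>))\<^sup>2) \<partial>DQ) = ennreal (W \<omega>) * (\<integral>\<^sup>+s. ennreal ((Q s (Y \<omega>))\<^sup>2) \<partial>DQ)"
      using W_nonneg[OF \<open>\<omega> \<in> space M\<close>] by (simp add: ennreal_mult' nn_integral_cmult)
    also have "\<dots> \<le> ennreal (W \<omega>) * ennreal ((\<sigma> + 1) * (Y \<omega>)\<^sup>2)"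
      by (intro mult_left_mono unbiased_quantizer_second_moment[OF quant]) simp
    also have "\<dots> = ennreal ((\<sigma> + 1) * (W \<omega> * (Y \<omega>)\<^sup>2))"
      using W_nonneg[OF \<open>\<omega> \<in> space M\<close>] by (simp add: ennreal_mult'[symmetric] ac_simps)
    finally show "(\<integral>\<^sup>+s. ennreal (W \<omega> * (Q s (Y \<omega>))\<^sup>2) \<partial>DQ) \<le> ennreal ((\<sigma> + 1) * (W \<omega> * (Y \<omega>)\<^sup>2))" .
  qed
  finally have le: "(\<integral>\<^sup>+\<omega>. ennreal (W \<omega> * (Q (Z \<omega>) (Y \<omega>))\<^sup>2) \<partial>M)
      \<le> (\<integral>\<^sup>+\<omega>. ennreal ((\<sigma> + 1) * (W \<omega> * (Y \<omega>)\<^sup>2)) \<partial>M)" .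
  \<comment> \<open>The variance bound at the argument 1 forces the sign of \<sigma>.\<close>
  have "0 \<le> \<sigma>"
  proof -
    have "0 \<le> (\<integral>s. (norm (Q s 1 - 1))\<^sup>2 \<partial>DQ)" by (rule Bochner_Integration.integral_nonneg) simp
    also have "\<dots> \<le> \<sigma> * (norm (1::real))\<^sup>2" using quant unfolding unbiased_quantizer_def by blast
    finally show ?thesis by simp
  qed
  have "(\<integral>\<^sup>+\<omega>. ennreal ((\<sigma> + 1) * (W \<omega> * (Y \<omega>)\<^sup>2)) \<partial>M) = ennreal ((\<sigma> + 1) * expectation (\<lambda>\<omega>. W \<omega> * (Y \<omega>)\<^sup>2))"
    using int W_nonneg \<open>0 \<le> \<sigma>\<close>
    by (subst nn_integral_eq_integral) (auto intro!: AE_I2)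
  note le = le[unfolded this]
  show int': "integrable M (\<lambda>\<omega>. W \<omega> * (Q (Z \<omega>) (Y \<omega>))\<^sup>2)"
  proof (rule integrableI_nonneg)
    show "(\<integral>\<^sup>+\<omega>. ennreal (W \<omega> * (Q (Z \<omega>) (Y \<omega>))\<^sup>2) \<partial>M) < \<infinity>"
      using le by (rule le_less_trans) simp
  qed (auto intro!: AE_I2 mult_nonneg_nonneg W_nonneg)
  have "ennreal (expectation (\<lambda>\<omega>. W \<omega> * (Q (Z \<omega>) (Y \<omega>))\<^sup>2)) = (\<integral>\<^sup>+\<omega>. ennreal (W \<omega> * (Q (Z \<omega>) (Y \<omega>))\<^sup>2) \<partial>M)"
    using int' W_nonneg by (intro nn_integral_eq_integral[symmetric]) (auto intro!: AE_I2)
  also note le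
  finally show "expectation (\<lambda>\<omega>. W \<omega> * (Q (Z \<omega>) (Y \<omega>))\<^sup>2) \<le> (\<sigma> + 1) * expectation (\<lambda>\<omega>. W \<omega> * (Y \<omega>)\<^sup>2)"
    using W_nonneg \<open>0 \<le> \<sigma>\<close>
    by (subst (asm) ennreal_le_iff)
       (auto intro!: mult_nonneg_nonneg Bochner_Integration.integral_nonneg_AE AE_I2)
qed

subsection \<open>The iteration\<close>

fun draw_time :: "draw \<Rightarrow> nat" where
  "draw_time (Perturb k) = k"
| "draw_time (Sample k) = k"
| "draw_time (Receive k) = k"
| "draw_time (DeviceSeed i k) = k"
| "draw_time (ServerSeed k) = k"

text \<open>The step sizes are arbitrary positive sequences here; their decay matters only when the
  sums in the telescoped inequality are evaluated.\<close>

locale dzofl = prob_space M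
  for M :: "'w measure" +
  fixes N :: nat
    and D :: "nat \<Rightarrow> 'x measure" and f :: "nat \<Rightarrow> real^'d \<Rightarrow> 'x \<Rightarrow> real"
    and DQ :: "'q measure" and Q :: "'q \<Rightarrow> real \<Rightarrow> real"
    and \<Phi> :: "nat \<Rightarrow> 'w \<Rightarrow> real^'d" and \<xi> :: "nat \<Rightarrow> nat \<Rightarrow> 'w \<Rightarrow> 'x"
    and S :: "nat \<Rightarrow> 'w \<Rightarrow> nat set"
    and \<zeta> :: "nat \<Rightarrow> nat \<Rightarrow> 'w \<Rightarrow> 'q" and \<eta> :: "nat \<Rightarrow> 'w \<Rightarrow> 'q"
    and \<theta> g :: "nat \<Rightarrow> 'w \<Rightarrow> real^'d" and \<Delta>f :: "nat \<Rightarrow> nat \<Rightarrow> 'w \<Rightarrow> real"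
    and \<Delta>fs :: "nat \<Rightarrow> 'w \<Rightarrow> real"
    and \<alpha> \<gamma> :: "nat \<Rightarrow> real" and \<theta>\<^sub>0 \<theta>star :: "real^'d"
    and Lip :: "nat \<Rightarrow> 'x \<Rightarrow> real" and F :: "real^'d \<Rightarrow> real"
    and p L L\<^sub>\<xi> \<sigma> \<alpha>\<^sub>1 \<alpha>\<^sub>2 \<alpha>\<^sub>3 :: real
  assumes N_pos: "N \<ge> 1" and p_pos: "0 < p" and p_le: "p \<le> 1"
    and \<Phi>_meas: "\<And>k. \<Phi> k \<in> borel_measurable M"
    and \<xi>_distr: "\<And>i k. i \<in> {1..N} \<Longrightarrow> \<xi> i k \<in> measurable M (D i) \<and> distr M (D i) (\<xi> i k) = D i"
    and S_meas: "\<And>k. S k \<in> measurable M (count_space (Pow {1..N}))"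
    and S_prob: "\<And>i k. i \<in> {1..N} \<Longrightarrow> measure M {\<omega> \<in> space M. i \<in> S k \<omega>} = p"
    and S_indep: "\<And>k. indep_events (\<lambda>i. {\<omega> \<in> space M. i \<in> S k \<omega>}) {1..N}"
    and \<zeta>_distr: "\<And>i k. i \<in> {1..N} \<Longrightarrow> \<zeta> i k \<in> measurable M DQ \<and> distr M DQ (\<zeta> i k) = DQ"
    and \<eta>_distr: "\<And>k. \<eta> k \<in> measurable M DQ \<and> distr M DQ (\<eta> k) = DQ"
    and draws_indep: "indep_sets (draw_events M N D DQ \<Phi> \<xi> S \<zeta> \<eta>) (draws N)"
    and \<theta>_0: "\<And>\<omega>. \<omega> \<in> space M \<Longrightarrow> \<theta> 0 \<omega> = \<theta>\<^sub>0"
    and \<Delta>f_eq: "\<And>i k \<omega>. i \<in> {1..N} \<Longrightarrow> \<omega> \<in> space M \<Longrightarrow>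
        \<Delta>f i k \<omega> = f i (\<theta> k \<omega> + \<gamma> k *\<^sub>R \<Phi> k \<omega>) (\<xi> i k \<omega>) - f i (\<theta> k \<omega> - \<gamma> k *\<^sub>R \<Phi> k \<omega>) (\<xi> i k \<omega>)"
    and \<Delta>fs_eq: "\<And>k \<omega>. \<omega> \<in> space M \<Longrightarrow>
        \<Delta>fs k \<omega> = server_average N (S k \<omega>) (\<lambda>i. Q (\<zeta> i k \<omega>) (\<Delta>f i k \<omega>))"
    and g_eq: "\<And>k \<omega>. \<omega> \<in> space M \<Longrightarrow> g k \<omega> = Q (\<eta> k \<omega>) (\<Delta>fs k \<omega>) *\<^sub>R \<Phi> k \<omega>"
    and \<theta>_Suc: "\<And>k \<omega>. \<omega> \<in> space M \<Longrightarrow> \<theta> (Suc k) \<omega> = \<theta> k \<omega> - \<alpha> k *\<^sub>R g k \<omega>"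
    and \<alpha>_pos: "\<And>k. \<alpha> k > 0" and \<gamma>_pos: "\<And>k. \<gamma> k > 0"
    and F_eq: "F = global_obj N D f"
    and \<theta>star_min: "\<And>t. F \<theta>star \<le> F t" and \<theta>star_grad: "grad F \<theta>star = 0"
    and F_diff: "\<And>i t. i \<in> {1..N} \<Longrightarrow> local_obj D f i differentiable (at t)"
    and F_diff2: "\<And>i t. i \<in> {1..N} \<Longrightarrow> grad (local_obj D f i) differentiable (at t)"
    and \<alpha>\<^sub>1_pos: "\<alpha>\<^sub>1 > 0"
    and hess_bound: "\<And>i t. i \<in> {1..N} \<Longrightarrow> spectral_norm (hessian (local_obj D f i) t) \<le> \<alpha>\<^sub>1"
    and L_pos: "L > 0" and F_smooth: "\<And>t t'. norm (grad F t - grad F t') \<le> L * norm (t - t')"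
    and f_Lip: "\<And>i t t' x. i \<in> {1..N} \<Longrightarrow> x \<in> space (D i) \<Longrightarrow>
        \<bar>f i t x - f i t' x\<bar> \<le> Lip i x * norm (t - t')"
    and Lip_meas: "\<And>i. i \<in> {1..N} \<Longrightarrow> Lip i \<in> borel_measurable (D i)"
    and L\<^sub>\<xi>_nonneg: "L\<^sub>\<xi> \<ge> 0"
    and L\<^sub>\<xi>_eq: "AE \<omega> in M. ennreal L\<^sub>\<xi> =
        Max ((\<lambda>i. nn_cond_exp M (history M N D \<theta> \<xi> 0) (\<lambda>\<omega>'. ennreal ((Lip i (\<xi> i 0 \<omega>'))\<^sup>2)) \<omega>) ` {1..N})"
    and f_int: "\<And>i t. i \<in> {1..N} \<Longrightarrow> integrable (D i) (f i t)"
    and \<sigma>_pos: "\<sigma> > 0" and Q_unbiased: "unbiased_quantizer DQ Q \<sigma>"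
    and \<Phi>_uncorr: "\<And>k j j'. j \<noteq> j' \<Longrightarrow> (\<integral>\<omega>. \<Phi> k \<omega> $ j * \<Phi> k \<omega> $ j' \<partial>M) = 0"
    and \<alpha>\<^sub>2_pos: "\<alpha>\<^sub>2 > 0" and \<Phi>_var: "\<And>k j. (\<integral>\<omega>. (\<Phi> k \<omega> $ j)\<^sup>2 \<partial>M) = \<alpha>\<^sub>2"
    and \<alpha>\<^sub>3_pos: "\<alpha>\<^sub>3 > 0" and \<Phi>_bound: "\<And>k. AE \<omega> in M. norm (\<Phi> k \<omega>) \<le> \<alpha>\<^sub>3"
begin

subsubsection \<open>The objective\<close>

lemma GDERIV_local_obj: "i \<in> {1..N} \<Longrightarrow> GDERIV (local_obj D f i) t :> grad (local_obj D f i) t"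
  using F_diff by (rule GDERIV_grad)

lemma F_sum: "F = (\<lambda>t. \<Sum>i=1..N. local_obj D f i t)"
  by (auto simp: F_eq global_obj_def)

lemma GDERIV_F_sum: "GDERIV F t :> (\<Sum>i=1..N. grad (local_obj D f i) t)"
  unfolding F_sum by (rule GDERIV_sum) (rule GDERIV_local_obj)

lemma grad_F: "grad F t = (\<Sum>i=1..N. grad (local_obj D f i) t)"
  using GDERIV_F_sum by (rule grad_eqI)

lemma GDERIV_F: "GDERIV F t :> grad F t"
  unfolding grad_F by (rule GDERIV_F_sum)

lemma F_continuous: "continuous_on UNIV F"
  using GDERIV_F unfolding gderiv_def
  by (meson continuous_at_imp_continuous_on has_derivative_continuous)

lemma F_borel [measurable]: "F \<in> borel_measurable borel"
  using F_continuous by (rule borel_measurable_continuous_onI)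

lemma grad_F_borel [measurable]: "grad F \<in> borel_measurable borel"
proof (rule borel_measurable_continuous_onI)
  have "L-lipschitz_on UNIV (grad F)"
    using F_smooth L_pos by (intro lipschitz_onI) (auto simp: dist_norm)
  then show "continuous_on UNIV (grad F)" by (rule lipschitz_on_continuous_on)
qed

lemma F_descent: "F (t + u) \<le> F t + u \<bullet> grad F t + L / 2 * (norm u)\<^sup>2"
  using GDERIV_F F_smooth by (rule smooth_upper)

lemma grad_F_norm_le: "norm (grad F t) \<le> L * norm (t - \<theta>star)"
  using F_smooth[of t \<theta>star] by (simp add: \<theta>star_grad)

text \<open>The local errors are added up, each with the Hessian bound of its own device. This is
  the origin of the factor \<open>real N * \<alpha>\<^sub>1\<close> in \<open>c\<^sub>3\<close>; the
  constant \<open>L\<close> serves the descent inequality.\<close>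

lemma F_central_difference:
  "\<bar>(\<Sum>i=1..N. local_obj D f i (t + u) - local_obj D f i (t - u)) - 2 * (u \<bullet> grad F t)\<bar>
    \<le> real N * \<alpha>\<^sub>1 * (norm u)\<^sup>2"
proof -
  let ?r = "\<lambda>i. local_obj D f i (t + u) - local_obj D f i (t - u) - 2 * (u \<bullet> grad (local_obj D f i) t)"
  have "\<bar>?r i\<bar> \<le> \<alpha>\<^sub>1 * (norm u)\<^sup>2" if "i \<in> {1..N}" for i
    using GDERIV_local_obj[OF that] grad_Lipschitz_if_hessian_bound[OF F_diff2[OF that] hess_bound[OF that]]
    by (rule smooth_central_difference)
  then have "(\<Sum>i=1..N. \<bar>?r i\<bar>) \<le> (\<Sum>i=1..N. \<alpha>\<^sub>1 * (norm u)\<^sup>2)" by (rule sum_mono)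
  then have "\<bar>\<Sum>i=1..N. ?r i\<bar> \<le> real N * \<alpha>\<^sub>1 * (norm u)\<^sup>2"
    using order_trans[OF sum_abs[of ?r "{1..N}"]] by (simp add: mult.assoc)
  then show ?thesis
    by (simp add: grad_F inner_sum_right sum_subtractf sum_distrib_left)
qed

subsubsection \<open>The information carried by the draws\<close>

abbreviation ev :: "draw \<Rightarrow> 'w set set" where
  "ev \<equiv> draw_events M N D DQ \<Phi> \<xi> S \<zeta> \<eta>"

text \<open>Takes the place of a filtration. Indexing by sets of draws instead of time allows an
  iteration to be cut between its own draws.\<close>

definition drawn :: "draw set \<Rightarrow> 'w measure" where
  "drawn I = sigma (space M) (\<Union>d\<in>I. ev d)"

lemma ev_space: "a \<in> ev d \<Longrightarrow> a \<subseteq> space M"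
  by (cases d; simp; drule sets.sets_into_space; simp)

lemma space_drawn [simp]: "space (drawn I) = space M"
  unfolding drawn_def by (rule space_measure_of) (use ev_space in blast)

lemma sets_drawn: "sets (drawn I) = sigma_sets (space M) (\<Union>d\<in>I. ev d)"
  unfolding drawn_def by (rule sets_measure_of) (use ev_space in blast)

lemma measurable_drawn_mono:
  assumes "X \<in> measurable (drawn I) T" and "I \<subseteq> J"
  shows "X \<in> measurable (drawn J) T"
proof -
  have "sets (drawn I) \<subseteq> sets (drawn J)"
    unfolding sets_drawn using \<open>I \<subseteq> J\<close> by (intro sigma_sets_mono') blast
  then show ?thesis using assms(1) unfolding measurable_def by auto
qed

lemma sets_drawn_events: "I \<subseteq> draws N \<Longrightarrow> sets (drawn I) \<subseteq> events"
  unfolding sets_drawn using draws_indep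
  by (intro sets.sigma_sets_subset) (auto simp: indep_sets_def)

lemma measurable_drawnD:
  assumes "X \<in> measurable (drawn I) T" and "I \<subseteq> draws N"
  shows "X \<in> measurable M T"
  using assms(1) sets_drawn_events[OF assms(2)] unfolding measurable_def by auto

text \<open>Disjoint blocks of an independent family generate independent sigma-algebras because
  each class of events is closed under intersection. The block \<open>{d}\<close> is the draw about
  to be integrated out.\<close>

lemma indep_drawn:
  assumes "I \<subseteq> draws N" and "d \<in> draws N" and "d \<notin> I"
  shows "indep_set (sets (drawn I)) (sets (drawn {d}))"
proof -
  let ?J = "case_bool I {d}"
  have "indep_sets (\<lambda>j. sigma_sets (space M) (\<Union>i\<in>?J j. ev i)) UNIV"
  proof (rule indep_sets_collect_sigma)
    show "indep_sets ev (\<Union>j\<in>UNIV. ?J j)"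
      using draws_indep by (rule indep_sets_mono_index[rotated]) (use assms in \<open>auto split: bool.splits\<close>)
    show "Int_stable (ev i)" for i
      by (cases i) (auto simp: Int_stable_def)
    show "disjoint_family_on ?J UNIV"
      using assms by (auto simp: disjoint_family_on_def split: bool.splits)
  qed
  moreover have "(\<lambda>j. sigma_sets (space M) (\<Union>i\<in>?J j. ev i)) = case_bool (sets (drawn I)) (sets (drawn {d}))"
    by (auto simp: sets_drawn fun_eq_iff split: bool.split)
  ultimately show ?thesis unfolding indep_set_def by simp
qed

lemma measurable_drawn_vimage:
  assumes "ev d = sets (vimage_algebra (space M) X T)" and "X \<in> space M \<rightarrow> space T" and "d \<in> I"
  shows "X \<in> measurable (drawn I) T"
proof (rule measurableI)
  fix A assume "A \<in> sets T"
  then have "X -` A \<inter> space M \<in> ev d" unfolding assms(1) by (rule in_vimage_algebra)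
  then show "X -` A \<inter> space (drawn I) \<in> sets (drawn I)"
    unfolding sets_drawn using \<open>d \<in> I\<close> by auto
qed (use assms(2) in auto)

lemma \<Phi>_drawn: "Perturb k \<in> I \<Longrightarrow> \<Phi> k \<in> borel_measurable (drawn I)"
  by (rule measurable_drawn_vimage) auto

lemma S_drawn: "Receive k \<in> I \<Longrightarrow> S k \<in> measurable (drawn I) (count_space (Pow {1..N}))"
  using measurable_space[OF S_meas] by (intro measurable_drawn_vimage[of "Receive k"]) auto

lemma \<zeta>_drawn: "DeviceSeed i k \<in> I \<Longrightarrow> i \<in> {1..N} \<Longrightarrow> \<zeta> i k \<in> measurable (drawn I) DQ"
  using \<zeta>_distr by (intro measurable_drawn_vimage[of "DeviceSeed i k"]) (auto dest: measurable_space)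

lemma \<eta>_drawn: "ServerSeed k \<in> I \<Longrightarrow> \<eta> k \<in> measurable (drawn I) DQ"
  using \<eta>_distr by (intro measurable_drawn_vimage[of "ServerSeed k"]) (auto dest: measurable_space)

text \<open>The draw \<open>Sample k\<close> reveals the whole sample vector, of which the sample of
  one device is a coordinate.\<close>

lemma \<xi>_drawn:
  assumes "Sample k \<in> I" and i: "i \<in> {1..N}"
  shows "\<xi> i k \<in> measurable (drawn I) (D i)"
proof -
  have "\<xi> j k \<omega> \<in> space (D j)" if "j \<in> {1..N}" "\<omega> \<in> space M" for j \<omega>
    using \<xi>_distr[OF that(1)] that(2) by (blast dest: measurable_space)
  then have "sample_vec N \<xi> k \<in> space M \<rightarrow> space (PiM {1..N} D)"
    unfolding sample_vec_def space_PiM by (intro Pi_I) (simp add: restrict_PiE_iff)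
  then have "sample_vec N \<xi> k \<in> measurable (drawn I) (PiM {1..N} D)"
    using assms(1) by (intro measurable_drawn_vimage[of "Sample k"]) simp_all
  then have "(\<lambda>\<omega>. sample_vec N \<xi> k \<omega> i) \<in> measurable (drawn I) (D i)"
    using i by (rule measurable_compose[OF _ measurable_component_singleton])
  then show ?thesis using i by (simp add: sample_vec_def)
qed

text \<open>The query point is itself random, so measurability in the sample for each fixed
  parameter has to be combined with Lipschitz continuity in the parameter.\<close>

lemma f_measurable:
  assumes i: "i \<in> {1..N}" and "t \<in> borel_measurable K" and "x \<in> measurable K (D i)"
  shows "(\<lambda>\<omega>. f i (t \<omega>) (x \<omega>)) \<in> borel_measurable K"
proof -
  have "(\<lambda>(t, x). f i t x) \<in> borel_measurable (borel \<Otimes>\<^sub>M D i)"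
  proof (rule measurable_if_continuous_fst)
    show "f i t \<in> borel_measurable (D i)" for t using f_int[OF i] by auto
    fix x assume x: "x \<in> space (D i)"
    \<comment> \<open>The absolute value supplies the nonnegative constant that
      \<open>lipschitz_on\<close> requires.\<close>
    have "\<bar>Lip i x\<bar>-lipschitz_on UNIV (\<lambda>t. f i t x)"
    proof (intro lipschitz_onI)
      fix t t'
      have "\<bar>f i t x - f i t' x\<bar> \<le> Lip i x * norm (t - t')" by (rule f_Lip[OF i x])
      also have "\<dots> \<le> \<bar>Lip i x\<bar> * norm (t - t')" by (intro mult_right_mono) auto
      finally show "dist (f i t x) (f i t' x) \<le> \<bar>Lip i x\<bar> * dist t t'"
        by (simp add: dist_norm)
    qed simp
    then show "continuous_on UNIV (\<lambda>t. f i t x)" by (rule lipschitz_on_continuous_on)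
  qed
  moreover have "(\<lambda>\<omega>. (t \<omega>, x \<omega>)) \<in> measurable K (borel \<Otimes>\<^sub>M D i)"
    using assms(2,3) by (rule measurable_Pair)
  ultimately have "(\<lambda>\<omega>. case (t \<omega>, x \<omega>) of (t, x) \<Rightarrow> f i t x) \<in> borel_measurable K"
    by (rule measurable_compose[rotated])
  then show ?thesis by simp
qed

lemma weight_measurable:
  "S k \<in> measurable K (count_space (Pow {1..N})) \<Longrightarrow> (\<lambda>\<omega>. weight N i (S k \<omega>)) \<in> borel_measurable K"
  by (erule measurable_compose) simp

lemma \<Delta>f_drawn:
  assumes i: "i \<in> {1..N}" and \<theta>: "\<theta> k \<in> borel_measurable (drawn I)"
    and I: "Perturb k \<in> I" "Sample k \<in> I"
  shows "\<Delta>f i k \<in> borel_measurable (drawn I)"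
proof -
  note [measurable] = \<theta> \<Phi>_drawn[OF I(1)]
  have "(\<lambda>\<omega>. f i (\<theta> k \<omega> + \<gamma> k *\<^sub>R \<Phi> k \<omega>) (\<xi> i k \<omega>) - f i (\<theta> k \<omega> - \<gamma> k *\<^sub>R \<Phi> k \<omega>) (\<xi> i k \<omega>))
      \<in> borel_measurable (drawn I)"
    by (intro borel_measurable_diff f_measurable[OF i _ \<xi>_drawn[OF I(2) i]]) measurable
  then show ?thesis
    by (rule measurable_cong[THEN iffD2, rotated]) (simp only: space_drawn \<Delta>f_eq[OF i])
qed

lemma quantized_drawn:
  assumes i: "i \<in> {1..N}" and \<theta>: "\<theta> k \<in> borel_measurable (drawn I)"
    and I: "Perturb k \<in> I" "Sample k \<in> I" "DeviceSeed i k \<in> I"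
  shows "(\<lambda>\<omega>. Q (\<zeta> i k \<omega>) (\<Delta>f i k \<omega>)) \<in> borel_measurable (drawn I)"
  using \<zeta>_drawn[OF I(3) i] \<Delta>f_drawn[OF i \<theta> I(1,2)]
  by (rule unbiased_quantizer_measurable[OF Q_unbiased])

lemma S_subset: "\<omega> \<in> space M \<Longrightarrow> S k \<omega> \<subseteq> {1..N}"
  using measurable_space[OF S_meas] by auto

lemma \<Delta>fs_eq_weight:
  "\<omega> \<in> space M \<Longrightarrow> \<Delta>fs k \<omega> = (\<Sum>i\<in>{1..N}. weight N i (S k \<omega>) * Q (\<zeta> i k \<omega>) (\<Delta>f i k \<omega>))"
  unfolding \<Delta>fs_eq by (rule server_average_eq_weight) (rule S_subset)

lemma \<Delta>fs_drawn:
  assumes \<theta>: "\<theta> k \<in> borel_measurable (drawn I)"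
    and I: "Perturb k \<in> I" "Sample k \<in> I" "Receive k \<in> I" "\<And>i. i \<in> {1..N} \<Longrightarrow> DeviceSeed i k \<in> I"
  shows "\<Delta>fs k \<in> borel_measurable (drawn I)"
proof -
  have "(\<lambda>\<omega>. \<Sum>i\<in>{1..N}. weight N i (S k \<omega>) * Q (\<zeta> i k \<omega>) (\<Delta>f i k \<omega>)) \<in> borel_measurable (drawn I)"
    using I by (intro borel_measurable_sum borel_measurable_times weight_measurable S_drawn
        quantized_drawn[OF _ \<theta>]) auto
  then show ?thesis
    by (rule measurable_cong[THEN iffD2, rotated]) (simp add: \<Delta>fs_eq_weight)
qed

lemma g_drawn:
  assumes \<theta>: "\<theta> k \<in> borel_measurable (drawn I)"
    and I: "Perturb k \<in> I" "Sample k \<in> I" "Receive k \<in> I" "\<And>i. i \<in> {1..N} \<Longrightarrow> DeviceSeed i k \<in> I"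
      "ServerSeed k \<in> I"
  shows "g k \<in> borel_measurable (drawn I)"
proof -
  have "(\<lambda>\<omega>. Q (\<eta> k \<omega>) (\<Delta>fs k \<omega>)) \<in> borel_measurable (drawn I)"
    using \<eta>_drawn[OF I(5)] \<Delta>fs_drawn[OF \<theta> I(1-4)]
    by (rule unbiased_quantizer_measurable[OF Q_unbiased])
  then have "(\<lambda>\<omega>. Q (\<eta> k \<omega>) (\<Delta>fs k \<omega>) *\<^sub>R \<Phi> k \<omega>) \<in> borel_measurable (drawn I)"
    using \<Phi>_drawn[OF I(1)] by (rule borel_measurable_scaleR)
  then show ?thesis
    by (rule measurable_cong[THEN iffD2, rotated]) (simp add: g_eq)
qed

section \<open>Measurability of the iterates with respect to earlier draws\<close>

definition past :: "nat \<Rightarrow> draw set" where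
  "past k = {d \<in> draws N. draw_time d < k}"

lemma draws_iff [simp]:
  "Perturb k \<in> draws N" "Sample k \<in> draws N" "Receive k \<in> draws N" "ServerSeed k \<in> draws N"
  "DeviceSeed i k \<in> draws N \<longleftrightarrow> i \<in> {1..N}"
  by (auto simp: draws_def)

lemma \<theta>_drawn_past: "\<theta> k \<in> borel_measurable (drawn (past k))"
proof (induction k)
  case 0
  have "(\<lambda>_. \<theta>\<^sub>0) \<in> borel_measurable (drawn (past 0))" by simp
  then show ?case by (rule measurable_cong[THEN iffD2, rotated]) (simp add: \<theta>_0)
next
  case (Suc k)
  have "past k \<subseteq> past (Suc k)" by (auto simp: past_def)
  with Suc have \<theta>[measurable]: "\<theta> k \<in> borel_measurable (drawn (past (Suc k)))" by (rule measurable_drawn_mono)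
  have [measurable]: "g k \<in> borel_measurable (drawn (past (Suc k)))"
    by (rule g_drawn[OF \<theta>]) (auto simp: past_def)
  have "(\<lambda>\<omega>. \<theta> k \<omega> - \<alpha> k *\<^sub>R g k \<omega>) \<in> borel_measurable (drawn (past (Suc k)))" by measurable
  then show ?case by (rule measurable_cong[THEN iffD2, rotated]) (simp add: \<theta>_Suc)
qed

lemma \<theta>_drawn: "past k \<subseteq> I \<Longrightarrow> \<theta> k \<in> borel_measurable (drawn I)"
  using \<theta>_drawn_past by (rule measurable_drawn_mono)

lemma past_subset: "past k \<subseteq> draws N"
  by (auto simp: past_def)

lemma \<theta>_measurable [measurable]: "\<theta> k \<in> borel_measurable M"
  by (rule measurable_drawnD[OF \<theta>_drawn_past past_subset])

declare \<Phi>_meas [measurable]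

lemma drawn_all: "X \<in> measurable (drawn (draws N)) T \<Longrightarrow> X \<in> measurable M T"
  by (erule measurable_drawnD) simp

lemma \<Delta>f_measurable: "i \<in> {1..N} \<Longrightarrow> \<Delta>f i k \<in> borel_measurable M"
  by (rule drawn_all[OF \<Delta>f_drawn]) (auto intro: \<theta>_drawn[OF past_subset])

lemma \<Delta>fs_measurable [measurable]: "\<Delta>fs k \<in> borel_measurable M"
  by (rule drawn_all[OF \<Delta>fs_drawn]) (auto intro: \<theta>_drawn[OF past_subset])

lemma g_measurable [measurable]: "g k \<in> borel_measurable M"
  by (rule drawn_all[OF g_drawn]) (auto intro: \<theta>_drawn[OF past_subset])

subsubsection \<open>Second moments\<close>

text \<open>The history at time 0 suffices, because all the samples of device \<open>i\<close> have the law
  \<open>D i\<close>; its conditional expectation is bounded by the maximum over the devices.\<close>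

lemma Lip_moment:
  assumes i: "i \<in> {1..N}"
  shows "integrable M (\<lambda>\<omega>. (Lip i (\<xi> i k \<omega>))\<^sup>2)" and "expectation (\<lambda>\<omega>. (Lip i (\<xi> i k \<omega>))\<^sup>2) \<le> L\<^sub>\<xi>"
proof -
  let ?H = "history M N D \<theta> \<xi> 0"
  let ?l = "\<lambda>k \<omega>. ennreal ((Lip i (\<xi> i k \<omega>))\<^sup>2)"
  have \<xi>_m[measurable]: "\<xi> i k \<in> measurable M (D i)" and law: "distr M (D i) (\<xi> i k) = D i" for k
    using \<xi>_distr[OF i] by auto
  note [measurable] = Lip_meas[OF i]
  have l[measurable]: "?l k \<in> borel_measurable M" for k by measurable
  have "subalgebra M ?H"
  proof -
    have sub: "sets (vimage_algebra (space M) (\<theta> 0) borel) \<subseteq> events"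
      using \<theta>_measurable by (intro sets_image_in_sets) auto
    have eq: "?H = sigma (space M) (sets (vimage_algebra (space M) (\<theta> 0) borel))"
      by (simp add: history_def)
    have pow: "sets (vimage_algebra (space M) (\<theta> 0) borel) \<subseteq> Pow (space M)"
      using sub sets.space_closed by blast
    show ?thesis unfolding subalgebra_def eq
      using sets.sigma_sets_subset[OF sub] by (simp add: space_measure_of[OF pow] sets_measure_of[OF pow])
  qed
  then interpret H: finite_measure_subalgebra M ?H by unfold_locales
  have "(\<integral>\<^sup>+\<omega>. ?l k \<omega> \<partial>M) = (\<integral>\<^sup>+x. ennreal ((Lip i x)\<^sup>2) \<partial>D i)"
    by (subst law[of k, symmetric], subst nn_integral_distr) auto
  also have "\<dots> = (\<integral>\<^sup>+\<omega>. ?l 0 \<omega> \<partial>M)"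
    by (subst law[of 0, symmetric], subst nn_integral_distr) auto
  \<comment> \<open>The factor 1 is the test function in the defining property of the conditional
    expectation, which thus has the same integral as the variable itself.\<close>
  also have "\<dots> = (\<integral>\<^sup>+\<omega>. 1 * ?l 0 \<omega> \<partial>M)" by simp
  also have "\<dots> = (\<integral>\<^sup>+\<omega>. 1 * nn_cond_exp M ?H (?l 0) \<omega> \<partial>M)"
    by (rule H.nn_cond_exp_intg[symmetric]) (rule measurable_const, simp, rule l)
  also have "\<dots> \<le> (\<integral>\<^sup>+\<omega>. ennreal L\<^sub>\<xi> \<partial>M)"
  proof (rule nn_integral_mono_AE)
    show "AE \<omega> in M. 1 * nn_cond_exp M ?H (?l 0) \<omega> \<le> ennreal L\<^sub>\<xi>"
      using L\<^sub>\<xi>_eq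
    proof eventually_elim
      case (elim \<omega>)
      show ?case unfolding elim using i by (intro Max_ge) auto
    qed
  qed
  also have "\<dots> = ennreal L\<^sub>\<xi>" by (simp add: emeasure_space_1)
  finally have le: "(\<integral>\<^sup>+\<omega>. ?l k \<omega> \<partial>M) \<le> ennreal L\<^sub>\<xi>" .
  show int: "integrable M (\<lambda>\<omega>. (Lip i (\<xi> i k \<omega>))\<^sup>2)"
    by (rule integrableI_nonneg) (use le in \<open>auto intro: le_less_trans\<close>)
  show "expectation (\<lambda>\<omega>. (Lip i (\<xi> i k \<omega>))\<^sup>2) \<le> L\<^sub>\<xi>"
    using le nn_integral_eq_integral[OF int] L\<^sub>\<xi>_nonneg by (simp add: ennreal_le_iff)
qed

text \<open>The query points differ by \<open>2 * \<gamma> k\<close> times \<open>\<Phi> k\<close>,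
  whatever \<open>\<theta> k\<close> is, so no control of the iterates is needed. The factor 4 is
  the square of this 2.\<close>

lemma \<Delta>f_moment:
  assumes i: "i \<in> {1..N}"
  shows "integrable M (\<lambda>\<omega>. (\<Delta>f i k \<omega>)\<^sup>2)"
    and "expectation (\<lambda>\<omega>. (\<Delta>f i k \<omega>)\<^sup>2) \<le> 4 * (\<gamma> k)\<^sup>2 * \<alpha>\<^sub>3\<^sup>2 * L\<^sub>\<xi>"
proof -
  note [measurable] = \<Delta>f_measurable[OF i]
  let ?c = "4 * (\<gamma> k)\<^sup>2 * \<alpha>\<^sub>3\<^sup>2"
  have le: "AE \<omega> in M. (\<Delta>f i k \<omega>)\<^sup>2 \<le> ?c * (Lip i (\<xi> i k \<omega>))\<^sup>2"
    using \<Phi>_bound[of k] AE_space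
  proof eventually_elim
    case (elim \<omega>)
    have x: "\<xi> i k \<omega> \<in> space (D i)" using \<xi>_distr[OF i, of k] elim(2) by (auto dest: measurable_space)
    have "\<bar>\<Delta>f i k \<omega>\<bar> \<le> Lip i (\<xi> i k \<omega>) * norm ((\<theta> k \<omega> + \<gamma> k *\<^sub>R \<Phi> k \<omega>) - (\<theta> k \<omega> - \<gamma> k *\<^sub>R \<Phi> k \<omega>))"
      unfolding \<Delta>f_eq[OF i elim(2)] by (rule f_Lip[OF i x])
    also have "(\<theta> k \<omega> + \<gamma> k *\<^sub>R \<Phi> k \<omega>) - (\<theta> k \<omega> - \<gamma> k *\<^sub>R \<Phi> k \<omega>) = (2 * \<gamma> k) *\<^sub>R \<Phi> k \<omega>"
      by (simp add: scaleR_2[symmetric] algebra_simps)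
    finally have "\<bar>\<Delta>f i k \<omega>\<bar>\<^sup>2 \<le> (Lip i (\<xi> i k \<omega>) * norm ((2 * \<gamma> k) *\<^sub>R \<Phi> k \<omega>))\<^sup>2"
      by (intro power_mono) auto
    also have "\<dots> = (4 * (\<gamma> k)\<^sup>2 * (Lip i (\<xi> i k \<omega>))\<^sup>2) * (norm (\<Phi> k \<omega>))\<^sup>2"
      by (simp add: power_mult_distrib)
    also have "\<dots> \<le> (4 * (\<gamma> k)\<^sup>2 * (Lip i (\<xi> i k \<omega>))\<^sup>2) * \<alpha>\<^sub>3\<^sup>2"
      using elim(1) by (intro mult_left_mono power_mono) auto
    finally show ?case by (simp add: ac_simps)
  qed
  have int: "integrable M (\<lambda>\<omega>. ?c * (Lip i (\<xi> i k \<omega>))\<^sup>2)"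
    using Lip_moment(1)[OF i] by (rule integrable_mult_right)
  show *: "integrable M (\<lambda>\<omega>. (\<Delta>f i k \<omega>)\<^sup>2)"
    using int by (rule Bochner_Integration.integrable_bound) (use le in auto)
  have "expectation (\<lambda>\<omega>. (\<Delta>f i k \<omega>)\<^sup>2) \<le> expectation (\<lambda>\<omega>. ?c * (Lip i (\<xi> i k \<omega>))\<^sup>2)"
    using * int le by (rule integral_mono_AE)
  also have "\<dots> = ?c * expectation (\<lambda>\<omega>. (Lip i (\<xi> i k \<omega>))\<^sup>2)" by simp
  also have "\<dots> \<le> ?c * L\<^sub>\<xi>"
    using Lip_moment(2)[OF i] by (intro mult_left_mono) auto
  finally show "expectation (\<lambda>\<omega>. (\<Delta>f i k \<omega>)\<^sup>2) \<le> ?c * L\<^sub>\<xi>" .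
qed

abbreviation reception_prob :: real where
  "reception_prob \<equiv> 1 - (1 - p) ^ N"

lemma reception_prob_pos: "0 < reception_prob"
  using p_pos p_le N_pos by (simp add: power_less_one_iff)

text \<open>The source of the factor q, both in the cross term and in the second moment: the
  reception is independent of all that \<open>I\<close> contains.\<close>

lemma expectation_mult_weight:
  assumes i: "i \<in> {1..N}" and I: "I \<subseteq> draws N" "Receive k \<notin> I"
    and V: "V \<in> borel_measurable (drawn I)" "integrable M V"
  shows "integrable M (\<lambda>\<omega>. V \<omega> * weight N i (S k \<omega>))"
    and "expectation (\<lambda>\<omega>. V \<omega> * weight N i (S k \<omega>)) = reception_prob * expectation V"
proof -
  have w: "(\<lambda>\<omega>. weight N i (S k \<omega>)) \<in> borel_measurable (drawn {Receive k})"
    by (intro weight_measurable S_drawn) simp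
  have w_int: "integrable M (\<lambda>\<omega>. weight N i (S k \<omega>))"
    by (rule integral_finite_valued(1)[OF _ S_meas]) simp
  note prod = indep_set_integral_mult[OF indep_drawn[OF I(1) _ I(2)] space_drawn space_drawn V(1) w V(2) w_int]
  show "integrable M (\<lambda>\<omega>. V \<omega> * weight N i (S k \<omega>))" by (rule prod) simp
  show "expectation (\<lambda>\<omega>. V \<omega> * weight N i (S k \<omega>)) = reception_prob * expectation V"
    using prod(2) expectation_weight[OF S_meas S_prob S_indep i, of k] by simp
qed

text \<open>Nothing in the sets below is drawn after the draw they are named for, so that each draw of
  iteration \<open>k\<close> can be integrated out given the preceding ones.\<close>

definition before_server :: "nat \<Rightarrow> draw set" where
  "before_server k = past k \<union> {Perturb k, Sample k, Receive k} \<union> {DeviceSeed i k | i. i \<in> {1..N}}"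

definition before_quantizers :: "nat \<Rightarrow> draw set" where
  "before_quantizers k = past k \<union> {Perturb k, Sample k, Receive k}"

definition before_reception :: "nat \<Rightarrow> draw set" where
  "before_reception k = past k \<union> {Perturb k, Sample k}"

definition before_samples :: "nat \<Rightarrow> draw set" where
  "before_samples k = past k \<union> {Perturb k}"

lemma before_indep:
  "indep_set (sets (drawn (before_server k))) (sets (drawn {ServerSeed k}))"
  "i \<in> {1..N} \<Longrightarrow> indep_set (sets (drawn (before_quantizers k))) (sets (drawn {DeviceSeed i k}))"
  "indep_set (sets (drawn (before_samples k))) (sets (drawn {Sample k}))"
  "indep_set (sets (drawn (past k))) (sets (drawn {Perturb k}))"
  by (rule indep_drawn;
      force simp: before_server_def before_quantizers_def before_samples_def past_def)+

lemma before_reception_draws: "before_reception k \<subseteq> draws N" "Receive k \<notin> before_reception k"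
  by (auto simp: before_reception_def past_def)

lemma past_before:
  "past k \<subseteq> before_server k" "past k \<subseteq> before_quantizers k"
  "past k \<subseteq> before_reception k" "past k \<subseteq> before_samples k"
  by (auto simp: before_server_def before_quantizers_def before_reception_def before_samples_def)

lemma \<Delta>f_before:
  assumes i: "i \<in> {1..N}"
  shows "\<Delta>f i k \<in> borel_measurable (drawn (before_quantizers k))"
    and "\<Delta>f i k \<in> borel_measurable (drawn (before_reception k))"
  by (rule \<Delta>f_drawn[OF i \<theta>_drawn[OF past_before(2)]], simp_all add: before_quantizers_def)
     (rule \<Delta>f_drawn[OF i \<theta>_drawn[OF past_before(3)]], simp_all add: before_reception_def)

lemma \<Delta>fs_before: "\<Delta>fs k \<in> borel_measurable (drawn (before_server k))"
  by (rule \<Delta>fs_drawn[OF \<theta>_drawn[OF past_before(1)]]) (auto simp: before_server_def)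

text \<open>The server average is linear in the quantized values, so each device is treated alone,
  against information that contains no device seed of iteration \<open>k\<close>. In the weighted
  second moment the seed is integrated out while the weight is frozen, and the reception afterwards,
  giving one factor \<sigma> + 1 and one factor q.\<close>

lemma device_quantized:
  assumes i: "i \<in> {1..N}"
  shows "(\<lambda>\<omega>. Q (\<zeta> i k \<omega>) (\<Delta>f i k \<omega>)) \<in> borel_measurable M"
    and "integrable M (\<lambda>\<omega>. (Q (\<zeta> i k \<omega>) (\<Delta>f i k \<omega>))\<^sup>2)"
    and "integrable M (\<lambda>\<omega>. weight N i (S k \<omega>) * (Q (\<zeta> i k \<omega>) (\<Delta>f i k \<omega>))\<^sup>2)"
    and "expectation (\<lambda>\<omega>. weight N i (S k \<omega>) * (Q (\<zeta> i k \<omega>) (\<Delta>f i k \<omega>))\<^sup>2)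
      \<le> (\<sigma> + 1) * (reception_prob * (4 * (\<gamma> k)\<^sup>2 * \<alpha>\<^sub>3\<^sup>2 * L\<^sub>\<xi>))"
    and "\<And>W. W \<in> borel_measurable (drawn (before_quantizers k)) \<Longrightarrow>
      integrable M (\<lambda>\<omega>. W \<omega> * Q (\<zeta> i k \<omega>) (\<Delta>f i k \<omega>)) \<Longrightarrow>
      expectation (\<lambda>\<omega>. W \<omega> * Q (\<zeta> i k \<omega>) (\<Delta>f i k \<omega>)) = expectation (\<lambda>\<omega>. W \<omega> * \<Delta>f i k \<omega>)"
proof -
  have \<zeta>: "\<zeta> i k \<in> measurable (drawn {DeviceSeed i k}) DQ" using i by (intro \<zeta>_drawn) auto
  have law: "distr M DQ (\<zeta> i k) = DQ" using \<zeta>_distr[OF i] by simp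
  note quantized = Q_unbiased before_indep(2)[OF i] space_drawn space_drawn
  show "(\<lambda>\<omega>. Q (\<zeta> i k \<omega>) (\<Delta>f i k \<omega>)) \<in> borel_measurable M"
    by (rule quantized_measurable[OF quantized _ \<Delta>f_before(1)[OF i] \<zeta> law, of "\<lambda>_. 1"]) simp
  show "integrable M (\<lambda>\<omega>. (Q (\<zeta> i k \<omega>) (\<Delta>f i k \<omega>))\<^sup>2)"
    using integrable_quantized_square[OF quantized _ \<Delta>f_before(1)[OF i] \<zeta> law, of "\<lambda>_. 1"] \<Delta>f_moment(1)[OF i]
    by simp
  have w: "(\<lambda>\<omega>. weight N i (S k \<omega>)) \<in> borel_measurable (drawn (before_quantizers k))"
    by (intro weight_measurable S_drawn) (simp add: before_quantizers_def)
  have sq: "(\<lambda>\<omega>. (\<Delta>f i k \<omega>)\<^sup>2) \<in> borel_measurable (drawn (before_reception k))"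
    using \<Delta>f_before(2)[OF i] by measurable
  note weighted = expectation_mult_weight[OF i before_reception_draws sq \<Delta>f_moment(1)[OF i]]
  have int: "integrable M (\<lambda>\<omega>. weight N i (S k \<omega>) * (\<Delta>f i k \<omega>)\<^sup>2)"
    using weighted(1) by (simp add: mult.commute)
  show "integrable M (\<lambda>\<omega>. weight N i (S k \<omega>) * (Q (\<zeta> i k \<omega>) (\<Delta>f i k \<omega>))\<^sup>2)"
    by (rule integrable_quantized_square[OF quantized w \<Delta>f_before(1)[OF i] \<zeta> law weight_nonneg int])
  have "expectation (\<lambda>\<omega>. weight N i (S k \<omega>) * (Q (\<zeta> i k \<omega>) (\<Delta>f i k \<omega>))\<^sup>2)
      \<le> (\<sigma> + 1) * expectation (\<lambda>\<omega>. weight N i (S k \<omega>) * (\<Delta>f i k \<omega>)\<^sup>2)"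
    by (rule expectation_quantized_square_le[OF quantized w \<Delta>f_before(1)[OF i] \<zeta> law weight_nonneg int])
  also have "expectation (\<lambda>\<omega>. weight N i (S k \<omega>) * (\<Delta>f i k \<omega>)\<^sup>2) = reception_prob * expectation (\<lambda>\<omega>. (\<Delta>f i k \<omega>)\<^sup>2)"
    using weighted(2) by (simp add: mult.commute)
  also have "(\<sigma> + 1) * \<dots> \<le> (\<sigma> + 1) * (reception_prob * (4 * (\<gamma> k)\<^sup>2 * \<alpha>\<^sub>3\<^sup>2 * L\<^sub>\<xi>))"
    using \<sigma>_pos reception_prob_pos \<Delta>f_moment(2)[OF i] by (intro mult_left_mono) auto
  finally show "expectation (\<lambda>\<omega>. weight N i (S k \<omega>) * (Q (\<zeta> i k \<omega>) (\<Delta>f i k \<omega>))\<^sup>2)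
      \<le> (\<sigma> + 1) * (reception_prob * (4 * (\<gamma> k)\<^sup>2 * \<alpha>\<^sub>3\<^sup>2 * L\<^sub>\<xi>))" .
  show "expectation (\<lambda>\<omega>. W \<omega> * Q (\<zeta> i k \<omega>) (\<Delta>f i k \<omega>)) = expectation (\<lambda>\<omega>. W \<omega> * \<Delta>f i k \<omega>)"
    if "W \<in> borel_measurable (drawn (before_quantizers k))"
      "integrable M (\<lambda>\<omega>. W \<omega> * Q (\<zeta> i k \<omega>) (\<Delta>f i k \<omega>))" for W
    by (rule expectation_quantized[OF quantized that(1) \<Delta>f_before(1)[OF i] \<zeta> law that(2)])
qed

text \<open>One factor N comes from the Cauchy-Schwarz bound on the server average, the other from
  adding equal bounds over the devices.\<close>

lemma \<Delta>fs_moment: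
  shows "integrable M (\<lambda>\<omega>. (\<Delta>fs k \<omega>)\<^sup>2)"
    and "expectation (\<lambda>\<omega>. (\<Delta>fs k \<omega>)\<^sup>2)
      \<le> (real N)\<^sup>2 * ((\<sigma> + 1) * (reception_prob * (4 * (\<gamma> k)\<^sup>2 * \<alpha>\<^sub>3\<^sup>2 * L\<^sub>\<xi>)))"
proof -
  let ?b = "\<lambda>\<omega>. real N * (\<Sum>i\<in>{1..N}. weight N i (S k \<omega>) * (Q (\<zeta> i k \<omega>) (\<Delta>f i k \<omega>))\<^sup>2)"
  have le: "(\<Delta>fs k \<omega>)\<^sup>2 \<le> ?b \<omega>" if "\<omega> \<in> space M" for \<omega>
    unfolding \<Delta>fs_eq[OF that] by (rule server_average_square_le) (rule S_subset[OF that])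
  have int: "integrable M ?b"
    by (intro integrable_mult_right Bochner_Integration.integrable_sum device_quantized(3))
  show *: "integrable M (\<lambda>\<omega>. (\<Delta>fs k \<omega>)\<^sup>2)"
    using int by (rule Bochner_Integration.integrable_bound) (use le in \<open>auto intro!: AE_I2 intro: order_trans[OF _ abs_ge_self]\<close>)
  have "expectation (\<lambda>\<omega>. (\<Delta>fs k \<omega>)\<^sup>2) \<le> expectation ?b"
    using * int le by (rule integral_mono)
  also have "\<dots> = real N * (\<Sum>i\<in>{1..N}. expectation (\<lambda>\<omega>. weight N i (S k \<omega>) * (Q (\<zeta> i k \<omega>) (\<Delta>f i k \<omega>))\<^sup>2))"
    by (subst integral_mult_right_zero, subst Bochner_Integration.integral_sum)
       (auto intro: device_quantized(3))
  also have "\<dots> \<le> real N * (\<Sum>i\<in>{1..N}. (\<sigma> + 1) * (reception_prob * (4 * (\<gamma> k)\<^sup>2 * \<alpha>\<^sub>3\<^sup>2 * L\<^sub>\<xi>)))"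
    by (intro mult_left_mono sum_mono device_quantized(4)) auto
  finally show "expectation (\<lambda>\<omega>. (\<Delta>fs k \<omega>)\<^sup>2)
      \<le> (real N)\<^sup>2 * ((\<sigma> + 1) * (reception_prob * (4 * (\<gamma> k)\<^sup>2 * \<alpha>\<^sub>3\<^sup>2 * L\<^sub>\<xi>)))"
    by (simp add: power2_eq_square mult.assoc)
qed

lemma server_quantized:
  shows "(\<lambda>\<omega>. Q (\<eta> k \<omega>) (\<Delta>fs k \<omega>)) \<in> borel_measurable M"
    and "integrable M (\<lambda>\<omega>. (Q (\<eta> k \<omega>) (\<Delta>fs k \<omega>))\<^sup>2)"
    and "expectation (\<lambda>\<omega>. (Q (\<eta> k \<omega>) (\<Delta>fs k \<omega>))\<^sup>2) \<le> (\<sigma> + 1) * expectation (\<lambda>\<omega>. (\<Delta>fs k \<omega>)\<^sup>2)"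
    and "\<And>W. W \<in> borel_measurable (drawn (before_server k)) \<Longrightarrow>
      integrable M (\<lambda>\<omega>. W \<omega> * Q (\<eta> k \<omega>) (\<Delta>fs k \<omega>)) \<Longrightarrow>
      expectation (\<lambda>\<omega>. W \<omega> * Q (\<eta> k \<omega>) (\<Delta>fs k \<omega>)) = expectation (\<lambda>\<omega>. W \<omega> * \<Delta>fs k \<omega>)"
proof -
  have \<eta>: "\<eta> k \<in> measurable (drawn {ServerSeed k}) DQ" by (intro \<eta>_drawn) auto
  have law: "distr M DQ (\<eta> k) = DQ" using \<eta>_distr by simp
  note quantized = Q_unbiased before_indep(1) space_drawn space_drawn
  show "(\<lambda>\<omega>. Q (\<eta> k \<omega>) (\<Delta>fs k \<omega>)) \<in> borel_measurable M"
    by (rule quantized_measurable[OF quantized _ \<Delta>fs_before \<eta> law, of "\<lambda>_. 1"]) simp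
  show "integrable M (\<lambda>\<omega>. (Q (\<eta> k \<omega>) (\<Delta>fs k \<omega>))\<^sup>2)"
    using integrable_quantized_square[OF quantized _ \<Delta>fs_before \<eta> law, of "\<lambda>_. 1"] \<Delta>fs_moment(1)
    by simp
  show "expectation (\<lambda>\<omega>. (Q (\<eta> k \<omega>) (\<Delta>fs k \<omega>))\<^sup>2) \<le> (\<sigma> + 1) * expectation (\<lambda>\<omega>. (\<Delta>fs k \<omega>)\<^sup>2)"
    using expectation_quantized_square_le[OF quantized _ \<Delta>fs_before \<eta> law, of "\<lambda>_. 1"] \<Delta>fs_moment(1)
    by simp
  show "expectation (\<lambda>\<omega>. W \<omega> * Q (\<eta> k \<omega>) (\<Delta>fs k \<omega>)) = expectation (\<lambda>\<omega>. W \<omega> * \<Delta>fs k \<omega>)"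
    if "W \<in> borel_measurable (drawn (before_server k))"
      "integrable M (\<lambda>\<omega>. W \<omega> * Q (\<eta> k \<omega>) (\<Delta>fs k \<omega>))" for W
    by (rule expectation_quantized[OF quantized that(1) \<Delta>fs_before \<eta> law that(2)])
qed

text \<open>Each of the two quantizers costs a factor \<sigma> + 1. The bound
  \<open>\<alpha>\<^sub>3\<close> enters squared through the distance of the query points and
  squared again through the factor \<open>\<Phi> k\<close> of \<open>g k\<close>. The result is
  \<open>c\<^sub>2 * (\<gamma> k)\<^sup>2\<close>.\<close>

lemma g_moment:
  shows "integrable M (\<lambda>\<omega>. (norm (g k \<omega>))\<^sup>2)"
    and "expectation (\<lambda>\<omega>. (norm (g k \<omega>))\<^sup>2)
      \<le> 4 * reception_prob * (\<sigma> + 1)\<^sup>2 * \<alpha>\<^sub>3 ^ 4 * (real N)\<^sup>2 * L\<^sub>\<xi> * (\<gamma> k)\<^sup>2"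
proof -
  note [measurable] = server_quantized(1)
  let ?b = "\<lambda>\<omega>. \<alpha>\<^sub>3\<^sup>2 * (Q (\<eta> k \<omega>) (\<Delta>fs k \<omega>))\<^sup>2"
  have le: "AE \<omega> in M. (norm (g k \<omega>))\<^sup>2 \<le> ?b \<omega>"
    using \<Phi>_bound[of k] AE_space
  proof eventually_elim
    case (elim \<omega>)
    have "(norm (g k \<omega>))\<^sup>2 = (norm (\<Phi> k \<omega>))\<^sup>2 * (Q (\<eta> k \<omega>) (\<Delta>fs k \<omega>))\<^sup>2"
      by (simp add: g_eq[OF elim(2)] power_mult_distrib)
    also have "\<dots> \<le> ?b \<omega>"
      using elim(1) by (intro mult_right_mono power_mono) auto
    finally show ?case .
  qed
  have int: "integrable M ?b" using server_quantized(2) by (rule integrable_mult_right)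
  show *: "integrable M (\<lambda>\<omega>. (norm (g k \<omega>))\<^sup>2)"
    using int by (rule Bochner_Integration.integrable_bound) (use le in auto)
  have "expectation (\<lambda>\<omega>. (norm (g k \<omega>))\<^sup>2) \<le> expectation ?b"
    using * int le by (rule integral_mono_AE)
  also have "\<dots> \<le> \<alpha>\<^sub>3\<^sup>2 * ((\<sigma> + 1) * expectation (\<lambda>\<omega>. (\<Delta>fs k \<omega>)\<^sup>2))"
    using server_quantized(3) by (simp add: mult_left_mono)
  also have "\<dots> \<le> \<alpha>\<^sub>3\<^sup>2 * ((\<sigma> + 1) * ((real N)\<^sup>2 * ((\<sigma> + 1) * (reception_prob * (4 * (\<gamma> k)\<^sup>2 * \<alpha>\<^sub>3\<^sup>2 * L\<^sub>\<xi>)))))"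
    using \<Delta>fs_moment(2) \<sigma>_pos by (intro mult_left_mono) auto
  also have "\<dots> = 4 * reception_prob * (\<sigma> + 1)\<^sup>2 * \<alpha>\<^sub>3 ^ 4 * (real N)\<^sup>2 * L\<^sub>\<xi> * (\<gamma> k)\<^sup>2"
    by (simp add: power2_eq_square power4_eq_xxxx)
  finally show "expectation (\<lambda>\<omega>. (norm (g k \<omega>))\<^sup>2)
      \<le> 4 * reception_prob * (\<sigma> + 1)\<^sup>2 * \<alpha>\<^sub>3 ^ 4 * (real N)\<^sup>2 * L\<^sub>\<xi> * (\<gamma> k)\<^sup>2" .
qed

section \<open>Integrability of the iterates, the gradient and the objective\<close>

lemma integrable_norm_square_diff:
  fixes X Y :: "'w \<Rightarrow> real^'d"
  assumes [measurable]: "X \<in> borel_measurable M" "Y \<in> borel_measurable M"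
    and "integrable M (\<lambda>\<omega>. (norm (X \<omega>))\<^sup>2)" "integrable M (\<lambda>\<omega>. (norm (Y \<omega>))\<^sup>2)"
  shows "integrable M (\<lambda>\<omega>. (norm (X \<omega> - Y \<omega>))\<^sup>2)"
proof (rule Bochner_Integration.integrable_bound)
  show "integrable M (\<lambda>\<omega>. 2 * (norm (X \<omega>))\<^sup>2 + 2 * (norm (Y \<omega>))\<^sup>2)" using assms by auto
  have "(norm (x - y))\<^sup>2 \<le> 2 * (norm x)\<^sup>2 + 2 * (norm y)\<^sup>2" for x y :: "real^'d"
  proof -
    have "(norm (x - y))\<^sup>2 \<le> (norm x + norm y)\<^sup>2" by (intro power_mono norm_triangle_ineq4) auto
    also have "\<dots> \<le> 2 * (norm x)\<^sup>2 + 2 * (norm y)\<^sup>2"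
      using sum_squares_bound[of "norm x" "norm y"] by (simp add: power2_sum)
    finally show ?thesis .
  qed
  then show "AE \<omega> in M. norm ((norm (X \<omega> - Y \<omega>))\<^sup>2) \<le> norm (2 * (norm (X \<omega>))\<^sup>2 + 2 * (norm (Y \<omega>))\<^sup>2)"
    by (intro AE_I2) simp
qed simp

text \<open>The iterates need not be bounded, but the second moment of \<open>g k\<close> is finite
  irrespective of \<open>\<theta> k\<close>, so each step preserves square integrability, starting
  from a deterministic point.\<close>

lemma \<theta>_square_integrable: "integrable M (\<lambda>\<omega>. (norm (\<theta> k \<omega>))\<^sup>2)"
proof (induction k)
  case 0
  have "integrable M (\<lambda>_. (norm \<theta>\<^sub>0)\<^sup>2)" by simp
  then show ?case
    by (rule Bochner_Integration.integrable_cong[THEN iffD2, rotated 2]) (simp_all add: \<theta>_0)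
next
  case (Suc k)
  have "integrable M (\<lambda>\<omega>. (norm (\<theta> k \<omega> - \<alpha> k *\<^sub>R g k \<omega>))\<^sup>2)"
    using Suc g_moment(1)[of k] by (intro integrable_norm_square_diff) (auto simp: power_mult_distrib)
  then show ?case
    by (rule Bochner_Integration.integrable_cong[THEN iffD2, rotated 2]) (simp_all add: \<theta>_Suc)
qed

lemma \<theta>_dist_square_integrable: "integrable M (\<lambda>\<omega>. (norm (\<theta> k \<omega> - \<theta>star))\<^sup>2)"
  by (intro integrable_norm_square_diff \<theta>_square_integrable) auto

lemma grad_square_integrable: "integrable M (\<lambda>\<omega>. (norm (grad F (\<theta> k \<omega>)))\<^sup>2)"
proof (rule Bochner_Integration.integrable_bound)
  show "integrable M (\<lambda>\<omega>. L\<^sup>2 * (norm (\<theta> k \<omega> - \<theta>star))\<^sup>2)"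
    using \<theta>_dist_square_integrable by (rule integrable_mult_right)
  have "(norm (grad F t))\<^sup>2 \<le> L\<^sup>2 * (norm (t - \<theta>star))\<^sup>2" for t
    using power_mono[OF grad_F_norm_le, of t 2] by (simp add: power_mult_distrib)
  then show "AE \<omega> in M. norm ((norm (grad F (\<theta> k \<omega>)))\<^sup>2) \<le> norm (L\<^sup>2 * (norm (\<theta> k \<omega> - \<theta>star))\<^sup>2)"
    by (intro AE_I2) simp
qed simp

text \<open>Minimality bounds the objective below, and smoothness at a point of vanishing gradient
  bounds it above by a quadratic in the distance to \<open>\<theta>star\<close>.\<close>

lemma objective_integrable: "integrable M (\<lambda>\<omega>. F (\<theta> k \<omega>))"
proof (rule Bochner_Integration.integrable_bound)
  show "integrable M (\<lambda>\<omega>. \<bar>F \<theta>star\<bar> + L / 2 * (norm (\<theta> k \<omega> - \<theta>star))\<^sup>2)"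
    using \<theta>_dist_square_integrable by auto
  have "\<bar>F t\<bar> \<le> \<bar>F \<theta>star\<bar> + L / 2 * (norm (t - \<theta>star))\<^sup>2" for t
  proof -
    have "F t \<le> F \<theta>star + L / 2 * (norm (t - \<theta>star))\<^sup>2"
      using F_descent[of \<theta>star "t - \<theta>star"] by (simp add: \<theta>star_grad)
    moreover have "0 \<le> L / 2 * (norm (t - \<theta>star))\<^sup>2" using L_pos by simp
    ultimately show ?thesis using \<theta>star_min[of t] by linarith
  qed
  then show "AE \<omega> in M. norm (F (\<theta> k \<omega>)) \<le> norm (\<bar>F \<theta>star\<bar> + L / 2 * (norm (\<theta> k \<omega> - \<theta>star))\<^sup>2)"
    by (intro AE_I2) (auto intro: order_trans[OF _ abs_ge_self])
qed simp

subsubsection \<open>Descent in expectation\<close>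

text \<open>The inner product of the gradient with \<open>g k\<close> is this number times the
  quantized server average, so the cross term of the descent inequality is a product of two real
  variables.\<close>

definition align :: "nat \<Rightarrow> 'w \<Rightarrow> real" where
  "align k \<omega> = grad F (\<theta> k \<omega>) \<bullet> \<Phi> k \<omega>"

lemma align_drawn: "past k \<subseteq> I \<Longrightarrow> Perturb k \<in> I \<Longrightarrow> align k \<in> borel_measurable (drawn I)"
proof -
  assume I: "past k \<subseteq> I" "Perturb k \<in> I"
  note [measurable] = \<theta>_drawn[OF I(1)] \<Phi>_drawn[OF I(2)]
  show ?thesis unfolding align_def[abs_def] by measurable
qed

lemma align_measurable [measurable]: "align k \<in> borel_measurable M"
  unfolding align_def[abs_def] by measurable

text \<open>In the coordinate expansion of the square, each product of two gradient entries depends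
  on the past and each product of two perturbation entries on \<open>Perturb k\<close>, so
  expectations factor. Off-diagonal terms vanish and every diagonal one carries
  \<open>\<alpha>\<^sub>2\<close>.\<close>

lemma align_square:
  shows "integrable M (\<lambda>\<omega>. (align k \<omega>)\<^sup>2)"
    and "expectation (\<lambda>\<omega>. (align k \<omega>)\<^sup>2) = \<alpha>\<^sub>2 * expectation (\<lambda>\<omega>. (norm (grad F (\<theta> k \<omega>)))\<^sup>2)"
proof -
  let ?G = "\<lambda>j l \<omega>. grad F (\<theta> k \<omega>) $ j * grad F (\<theta> k \<omega>) $ l"
  let ?P = "\<lambda>j l \<omega>. \<Phi> k \<omega> $ j * \<Phi> k \<omega> $ l"
  have component: "\<bar>v $ j * v $ l\<bar> \<le> (norm v)\<^sup>2" for v :: "real^'d" and j l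
    using component_le_norm_cart[of v j] component_le_norm_cart[of v l]
    by (simp add: abs_mult power2_eq_square mult_mono)
  have [measurable]: "(\<lambda>v :: real^'d. v $ j) \<in> borel_measurable borel" for j
    by (intro borel_measurable_continuous_onI continuous_intros)
  have G_int: "integrable M (?G j l)" for j l
    using grad_square_integrable[of k]
    by (rule Bochner_Integration.integrable_bound) (use component in auto)
  have P_int: "integrable M (?P j l)" for j l
  proof (rule integrable_const_bound)
    show "AE \<omega> in M. norm (?P j l \<omega>) \<le> \<alpha>\<^sub>3\<^sup>2"
      using \<Phi>_bound[of k]
    proof eventually_elim
      case (elim \<omega>)
      show ?case using component[of "\<Phi> k \<omega>" j l] power_mono[OF elim, of 2] by simp
    qed
  qed simp
  have G_drawn: "?G j l \<in> borel_measurable (drawn (past k))" for j l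
    using \<theta>_drawn_past[of k] by measurable
  have P_drawn: "?P j l \<in> borel_measurable (drawn {Perturb k})" for j l
    using \<Phi>_drawn[of k "{Perturb k}"] by measurable
  note prod = indep_set_integral_mult[OF before_indep(4) space_drawn space_drawn G_drawn P_drawn G_int P_int]
  have eq: "(align k \<omega>)\<^sup>2 = (\<Sum>j\<in>UNIV. \<Sum>l\<in>UNIV. ?G j l \<omega> * ?P j l \<omega>)" for \<omega>
    by (simp add: align_def inner_vec_def power2_eq_square sum_product ac_simps)
  show "integrable M (\<lambda>\<omega>. (align k \<omega>)\<^sup>2)"
    unfolding eq by (intro Bochner_Integration.integrable_sum prod(1))
  have "expectation (\<lambda>\<omega>. (align k \<omega>)\<^sup>2) = (\<Sum>j\<in>UNIV. \<Sum>l\<in>UNIV. expectation (\<lambda>\<omega>. ?G j l \<omega> * ?P j l \<omega>))"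
    unfolding eq by (simp add: Bochner_Integration.integral_sum Bochner_Integration.integrable_sum prod(1))
  also have "\<dots> = (\<Sum>j\<in>UNIV. \<Sum>l\<in>UNIV. if l = j then expectation (?G j j) * \<alpha>\<^sub>2 else 0)"
  proof (intro sum.cong refl)
    fix j l
    show "expectation (\<lambda>\<omega>. ?G j l \<omega> * ?P j l \<omega>) = (if l = j then expectation (?G j j) * \<alpha>\<^sub>2 else 0)"
      unfolding prod(2) using \<Phi>_var[of k j] \<Phi>_uncorr[of j l k] by (auto simp: power2_eq_square)
  qed
  also have "\<dots> = \<alpha>\<^sub>2 * (\<Sum>j\<in>UNIV. expectation (?G j j))"
    by (simp add: sum_distrib_left mult.commute)
  also have "(\<Sum>j\<in>UNIV. expectation (?G j j)) = expectation (\<lambda>\<omega>. (norm (grad F (\<theta> k \<omega>)))\<^sup>2)"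
    unfolding power2_norm_eq_inner inner_vec_def inner_real_def
    by (rule Bochner_Integration.integral_sum[symmetric]) (rule G_int)
  finally show "expectation (\<lambda>\<omega>. (align k \<omega>)\<^sup>2) = \<alpha>\<^sub>2 * expectation (\<lambda>\<omega>. (norm (grad F (\<theta> k \<omega>)))\<^sup>2)" .
qed

text \<open>The mean of \<open>\<Delta>f i k\<close> when \<open>\<theta> k\<close> and
  \<open>\<Phi> k\<close> are held fixed and only the sample is averaged.\<close>

definition central :: "nat \<Rightarrow> nat \<Rightarrow> 'w \<Rightarrow> real" where
  "central i k \<omega> = local_obj D f i (\<theta> k \<omega> + \<gamma> k *\<^sub>R \<Phi> k \<omega>) - local_obj D f i (\<theta> k \<omega> - \<gamma> k *\<^sub>R \<Phi> k \<omega>)"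

text \<open>Both query points are determined by the past and the perturbation. Frozen, they turn the
  integral of the loss against \<open>D i\<close> into the local objective at these points.\<close>

lemma expectation_align_sample:
  assumes i: "i \<in> {1..N}"
  shows "integrable M (\<lambda>\<omega>. align k \<omega> * \<Delta>f i k \<omega>)"
    and "integrable M (\<lambda>\<omega>. align k \<omega> * central i k \<omega>)"
    and "expectation (\<lambda>\<omega>. align k \<omega> * \<Delta>f i k \<omega>) = expectation (\<lambda>\<omega>. align k \<omega> * central i k \<omega>)"
proof -
  show int: "integrable M (\<lambda>\<omega>. align k \<omega> * \<Delta>f i k \<omega>)"
    by (intro integrable_mult_square_integrable align_square(1) \<Delta>f_moment(1) \<Delta>f_measurable i) simp
  define X where "X \<omega> = (align k \<omega>, \<theta> k \<omega> + \<gamma> k *\<^sub>R \<Phi> k \<omega>, \<theta> k \<omega> - \<gamma> k *\<^sub>R \<Phi> k \<omega>)" for \<omega>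
  define h where "h y = fst (fst y) * (f i (fst (snd (fst y))) (snd y) - f i (snd (snd (fst y))) (snd y))"
    for y :: "(real \<times> (real^'d) \<times> (real^'d)) \<times> 'x"
  have X: "X \<in> measurable (drawn (before_samples k)) (borel \<Otimes>\<^sub>M borel \<Otimes>\<^sub>M borel)"
  proof -
    have P: "Perturb k \<in> before_samples k" by (simp add: before_samples_def)
    note [measurable] = align_drawn[OF past_before(4) P] \<theta>_drawn[OF past_before(4)] \<Phi>_drawn[OF P]
    show ?thesis unfolding X_def[abs_def] by measurable
  qed
  have h: "h \<in> borel_measurable ((borel \<Otimes>\<^sub>M borel \<Otimes>\<^sub>M borel) \<Otimes>\<^sub>M D i)"
    unfolding h_def[abs_def]
    by (intro borel_measurable_times borel_measurable_diff f_measurable[OF i]) measurable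
  have \<xi>: "\<xi> i k \<in> measurable (drawn {Sample k}) (D i)" using i by (intro \<xi>_drawn) auto
  have law: "distr M (D i) (\<xi> i k) = D i" using \<xi>_distr[OF i] by simp
  have hX: "h (X \<omega>, \<xi> i k \<omega>) = align k \<omega> * \<Delta>f i k \<omega>" if "\<omega> \<in> space M" for \<omega>
    unfolding h_def X_def by (simp only: fst_conv snd_conv \<Delta>f_eq[OF i that])
  have hX_int: "(\<integral>z. h (X \<omega>, z) \<partial>D i) = align k \<omega> * central i k \<omega>" for \<omega>
    unfolding h_def X_def central_def local_obj_def by (simp add: Bochner_Integration.integral_diff f_int[OF i])
  have "integrable M (\<lambda>\<omega>. h (X \<omega>, \<xi> i k \<omega>))"
    by (rule Bochner_Integration.integrable_cong[THEN iffD2, rotated 2, OF int]) (simp_all only: hX)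
  note Fubini = indep_set_integrable_fst[OF before_indep(3) space_drawn space_drawn X \<xi> h this]
    indep_set_integral_eq[OF before_indep(3) space_drawn space_drawn X \<xi> h this]
  show "integrable M (\<lambda>\<omega>. align k \<omega> * central i k \<omega>)"
    using Fubini(1) unfolding law hX_int .
  have "expectation (\<lambda>\<omega>. align k \<omega> * \<Delta>f i k \<omega>) = expectation (\<lambda>\<omega>. h (X \<omega>, \<xi> i k \<omega>))"
    by (intro Bochner_Integration.integral_cong) (simp_all only: hX)
  then show "expectation (\<lambda>\<omega>. align k \<omega> * \<Delta>f i k \<omega>) = expectation (\<lambda>\<omega>. align k \<omega> * central i k \<omega>)"
    using Fubini(2) unfolding law hX_int by simp
qed

text \<open>\<open>align k\<close> depends on the past and \<open>\<Phi> k\<close> only, so it stays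
  frozen through all the stages and can be carried along as a factor.\<close>

lemma expectation_align_quantized:
  shows "integrable M (\<lambda>\<omega>. align k \<omega> * Q (\<eta> k \<omega>) (\<Delta>fs k \<omega>))"
    and "expectation (\<lambda>\<omega>. align k \<omega> * Q (\<eta> k \<omega>) (\<Delta>fs k \<omega>))
      = reception_prob * expectation (\<lambda>\<omega>. align k \<omega> * (\<Sum>i=1..N. central i k \<omega>))"
proof -
  let ?w = "\<lambda>i \<omega>. weight N i (S k \<omega>)"
  show int: "integrable M (\<lambda>\<omega>. align k \<omega> * Q (\<eta> k \<omega>) (\<Delta>fs k \<omega>))"
    by (intro integrable_mult_square_integrable align_square(1) server_quantized) simp
  have align_server: "align k \<in> borel_measurable (drawn (before_server k))"
    by (rule align_drawn[OF past_before(1)]) (simp add: before_server_def)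
  \<comment> \<open>The weight is at most N, so \<open>align k\<close> times the weight stays square
    integrable; so is the quantized value.\<close>
  have device_int: "integrable M (\<lambda>\<omega>. (align k \<omega> * ?w i \<omega>) * Q (\<zeta> i k \<omega>) (\<Delta>f i k \<omega>))"
    if i: "i \<in> {1..N}" for i
  proof (intro integrable_mult_square_integrable device_quantized i)
    have [measurable]: "?w i \<in> borel_measurable M" by (rule weight_measurable[OF S_meas])
    show "(\<lambda>\<omega>. align k \<omega> * ?w i \<omega>) \<in> borel_measurable M" by measurable
    show "integrable M (\<lambda>\<omega>. (align k \<omega> * ?w i \<omega>)\<^sup>2)"
    proof (rule Bochner_Integration.integrable_bound)
      show "integrable M (\<lambda>\<omega>. (real N)\<^sup>2 * (align k \<omega>)\<^sup>2)"
        using align_square(1) by (rule integrable_mult_right)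
      have "(align k \<omega> * ?w i \<omega>)\<^sup>2 \<le> (real N)\<^sup>2 * (align k \<omega>)\<^sup>2" if "\<omega> \<in> space M" for \<omega>
      proof -
        have "(?w i \<omega>)\<^sup>2 \<le> (real N)\<^sup>2"
          by (intro power_mono weight_le S_subset that weight_nonneg)
        then have "(?w i \<omega>)\<^sup>2 * (align k \<omega>)\<^sup>2 \<le> (real N)\<^sup>2 * (align k \<omega>)\<^sup>2"
          by (rule mult_right_mono) simp
        then show ?thesis by (simp only: power_mult_distrib mult.commute)
      qed
      then show "AE \<omega> in M. norm ((align k \<omega> * ?w i \<omega>)\<^sup>2) \<le> norm ((real N)\<^sup>2 * (align k \<omega>)\<^sup>2)"
        by (intro AE_I2) simp
    qed measurable
  qed
  have device: "expectation (\<lambda>\<omega>. (align k \<omega> * ?w i \<omega>) * Q (\<zeta> i k \<omega>) (\<Delta>f i k \<omega>))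
      = reception_prob * expectation (\<lambda>\<omega>. align k \<omega> * central i k \<omega>)" if i: "i \<in> {1..N}" for i
  proof -
    have P: "Perturb k \<in> before_quantizers k" "Perturb k \<in> before_reception k"
      by (simp_all add: before_quantizers_def before_reception_def)
    have "(\<lambda>\<omega>. align k \<omega> * ?w i \<omega>) \<in> borel_measurable (drawn (before_quantizers k))"
      by (intro borel_measurable_times align_drawn past_before P weight_measurable S_drawn)
         (simp add: before_quantizers_def)
    then have "expectation (\<lambda>\<omega>. (align k \<omega> * ?w i \<omega>) * Q (\<zeta> i k \<omega>) (\<Delta>f i k \<omega>))
        = expectation (\<lambda>\<omega>. (align k \<omega> * ?w i \<omega>) * \<Delta>f i k \<omega>)"
      using device_int[OF i] by (rule device_quantized(5)[OF i])
    \<comment> \<open>The weight is moved outside because the reception is integrated out next, and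
      the rest of the product is known before it.\<close>
    also have "\<dots> = expectation (\<lambda>\<omega>. (align k \<omega> * \<Delta>f i k \<omega>) * ?w i \<omega>)"
      by (simp add: ac_simps)
    also have "\<dots> = reception_prob * expectation (\<lambda>\<omega>. align k \<omega> * \<Delta>f i k \<omega>)"
      by (intro expectation_mult_weight[OF i before_reception_draws] borel_measurable_times
          align_drawn past_before P \<Delta>f_before i expectation_align_sample)
    finally show ?thesis by (simp add: expectation_align_sample(3)[OF i])
  qed
  have "expectation (\<lambda>\<omega>. align k \<omega> * Q (\<eta> k \<omega>) (\<Delta>fs k \<omega>)) = expectation (\<lambda>\<omega>. align k \<omega> * \<Delta>fs k \<omega>)"
    using align_server int by (rule server_quantized(4))
  also have "\<dots> = expectation (\<lambda>\<omega>. \<Sum>i\<in>{1..N}. (align k \<omega> * ?w i \<omega>) * Q (\<zeta> i k \<omega>) (\<Delta>f i k \<omega>))"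
    by (intro Bochner_Integration.integral_cong refl) (simp add: \<Delta>fs_eq_weight sum_distrib_left mult.assoc)
  also have "\<dots> = (\<Sum>i\<in>{1..N}. reception_prob * expectation (\<lambda>\<omega>. align k \<omega> * central i k \<omega>))"
    using device_int device by (subst Bochner_Integration.integral_sum) (auto intro: sum.cong)
  also have "\<dots> = reception_prob * expectation (\<lambda>\<omega>. align k \<omega> * (\<Sum>i=1..N. central i k \<omega>))"
    unfolding sum_distrib_left using expectation_align_sample(2)
    by (subst Bochner_Integration.integral_sum) (auto simp: sum_distrib_left)
  finally show "expectation (\<lambda>\<omega>. align k \<omega> * Q (\<eta> k \<omega>) (\<Delta>fs k \<omega>))
      = reception_prob * expectation (\<lambda>\<omega>. align k \<omega> * (\<Sum>i=1..N. central i k \<omega>))" .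
qed

text \<open>This is \<open>c\<^sub>3\<close>. Its normalization writes the bound on
  \<open>align\<close> times the Taylor error as \<open>\<alpha>\<^sub>2 * \<gamma> k\<close> times
  2ab, with a the gradient norm and b equal to \<open>bias * \<gamma> k\<close>.\<close>

definition bias :: real where
  "bias = \<alpha>\<^sub>1 * \<alpha>\<^sub>3 ^ 3 * real N / (2 * \<alpha>\<^sub>2)"

text \<open>The Taylor error is absorbed pathwise. The price is one copy of
  \<open>\<alpha>\<^sub>2 * \<gamma> k\<close> times the squared gradient norm, while the leading
  term contributes two copies in expectation by \<open>align_square\<close>.\<close>

lemma align_central_ge:
  assumes \<Phi>: "norm (\<Phi> k \<omega>) \<le> \<alpha>\<^sub>3"
  shows "align k \<omega> * (\<Sum>i=1..N. central i k \<omega>)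
    \<ge> 2 * \<gamma> k * (align k \<omega>)\<^sup>2 - \<alpha>\<^sub>2 * \<gamma> k * ((norm (grad F (\<theta> k \<omega>)))\<^sup>2 + (bias * \<gamma> k)\<^sup>2)"
proof -
  let ?n = "norm (grad F (\<theta> k \<omega>))"
  let ?B = "\<Sum>i=1..N. central i k \<omega>"
  have "\<bar>?B - 2 * ((\<gamma> k *\<^sub>R \<Phi> k \<omega>) \<bullet> grad F (\<theta> k \<omega>))\<bar> \<le> real N * \<alpha>\<^sub>1 * (norm (\<gamma> k *\<^sub>R \<Phi> k \<omega>))\<^sup>2"
    unfolding central_def by (rule F_central_difference)
  then have "\<bar>?B - 2 * \<gamma> k * align k \<omega>\<bar> \<le> real N * \<alpha>\<^sub>1 * (norm (\<gamma> k *\<^sub>R \<Phi> k \<omega>))\<^sup>2"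
    by (simp add: align_def inner_commute)
  also have "\<dots> \<le> real N * \<alpha>\<^sub>1 * ((\<gamma> k)\<^sup>2 * \<alpha>\<^sub>3\<^sup>2)"
    using \<alpha>\<^sub>1_pos power_mono[OF \<Phi>, of 2] by (intro mult_left_mono) (auto simp: power_mult_distrib mult_left_mono)
  finally have r: "\<bar>?B - 2 * \<gamma> k * align k \<omega>\<bar> \<le> real N * \<alpha>\<^sub>1 * ((\<gamma> k)\<^sup>2 * \<alpha>\<^sub>3\<^sup>2)" .
  have a: "\<bar>align k \<omega>\<bar> \<le> ?n * \<alpha>\<^sub>3"
    unfolding align_def using Cauchy_Schwarz_ineq2[of "grad F (\<theta> k \<omega>)" "\<Phi> k \<omega>"] mult_left_mono[OF \<Phi>, of ?n]
    by simp
  have "\<bar>align k \<omega> * (?B - 2 * \<gamma> k * align k \<omega>)\<bar> \<le> (?n * \<alpha>\<^sub>3) * (real N * \<alpha>\<^sub>1 * ((\<gamma> k)\<^sup>2 * \<alpha>\<^sub>3\<^sup>2))"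
    unfolding abs_mult using a r \<alpha>\<^sub>3_pos by (intro mult_mono) auto
  also have "\<dots> = \<alpha>\<^sub>2 * \<gamma> k * (2 * ?n * (bias * \<gamma> k))"
    using \<alpha>\<^sub>2_pos by (simp add: bias_def power2_eq_square power3_eq_cube)
  \<comment> \<open>The inequality 2ab \<le> a^2 + b^2; it turns an error linear in the gradient
    norm into one that the leading term can pay for.\<close>
  also have "\<dots> \<le> \<alpha>\<^sub>2 * \<gamma> k * (?n\<^sup>2 + (bias * \<gamma> k)\<^sup>2)"
    using \<alpha>\<^sub>2_pos \<gamma>_pos[of k] by (intro mult_left_mono sum_squares_bound) auto
  finally show ?thesis by (simp add: power2_eq_square algebra_simps abs_le_iff)
qed

lemma expectation_align_quantized_ge:
  "expectation (\<lambda>\<omega>. align k \<omega> * Q (\<eta> k \<omega>) (\<Delta>fs k \<omega>))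
    \<ge> reception_prob * (\<alpha>\<^sub>2 * \<gamma> k * (expectation (\<lambda>\<omega>. (norm (grad F (\<theta> k \<omega>)))\<^sup>2) - (bias * \<gamma> k)\<^sup>2))"
proof -
  let ?n = "\<lambda>\<omega>. (norm (grad F (\<theta> k \<omega>)))\<^sup>2"
  let ?l = "\<lambda>\<omega>. 2 * \<gamma> k * (align k \<omega>)\<^sup>2 - \<alpha>\<^sub>2 * \<gamma> k * (?n \<omega> + (bias * \<gamma> k)\<^sup>2)"
  have "\<alpha>\<^sub>2 * \<gamma> k * (expectation ?n - (bias * \<gamma> k)\<^sup>2) = expectation ?l"
    using align_square[of k] grad_square_integrable[of k]
    by (simp add: prob_space algebra_simps)
  also have "\<dots> \<le> expectation (\<lambda>\<omega>. align k \<omega> * (\<Sum>i=1..N. central i k \<omega>))"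
  proof (rule integral_mono_AE)
    show "integrable M ?l" using align_square(1)[of k] grad_square_integrable[of k] by auto
    show "integrable M (\<lambda>\<omega>. align k \<omega> * (\<Sum>i=1..N. central i k \<omega>))"
      unfolding sum_distrib_left by (intro Bochner_Integration.integrable_sum expectation_align_sample(2))
    show "AE \<omega> in M. ?l \<omega> \<le> align k \<omega> * (\<Sum>i=1..N. central i k \<omega>)"
      using \<Phi>_bound[of k] by eventually_elim (rule align_central_ge)
  qed
  finally show ?thesis
    unfolding expectation_align_quantized(2) using reception_prob_pos by (intro mult_left_mono) auto
qed

lemma expected_descent:
  "expectation (\<lambda>\<omega>. F (\<theta> (Suc k) \<omega>)) \<le> expectation (\<lambda>\<omega>. F (\<theta> k \<omega>))
    - \<alpha> k * (reception_prob * (\<alpha>\<^sub>2 * \<gamma> k * (expectation (\<lambda>\<omega>. (norm (grad F (\<theta> k \<omega>)))\<^sup>2) - (bias * \<gamma> k)\<^sup>2)))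
    + L / 2 * (\<alpha> k)\<^sup>2 * (4 * reception_prob * (\<sigma> + 1)\<^sup>2 * \<alpha>\<^sub>3 ^ 4 * (real N)\<^sup>2 * L\<^sub>\<xi> * (\<gamma> k)\<^sup>2)"
proof -
  let ?a = "\<lambda>\<omega>. align k \<omega> * Q (\<eta> k \<omega>) (\<Delta>fs k \<omega>)"
  let ?u = "\<lambda>\<omega>. F (\<theta> k \<omega>) - \<alpha> k * ?a \<omega> + L / 2 * (\<alpha> k)\<^sup>2 * (norm (g k \<omega>))\<^sup>2"
  have int: "integrable M (\<lambda>\<omega>. F (\<theta> k \<omega>) - \<alpha> k * ?a \<omega>)" "integrable M (\<lambda>\<omega>. L / 2 * (\<alpha> k)\<^sup>2 * (norm (g k \<omega>))\<^sup>2)"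
    using objective_integrable[of k] expectation_align_quantized(1)[of k] g_moment(1)[of k] by auto
  have "expectation (\<lambda>\<omega>. F (\<theta> (Suc k) \<omega>)) \<le> expectation ?u"
  proof (rule integral_mono)
    show "integrable M (\<lambda>\<omega>. F (\<theta> (Suc k) \<omega>))" by (rule objective_integrable)
    show "integrable M ?u" using int by (rule Bochner_Integration.integrable_add)
    fix \<omega> assume \<omega>: "\<omega> \<in> space M"
    have "F (\<theta> (Suc k) \<omega>) = F (\<theta> k \<omega> + (- \<alpha> k *\<^sub>R g k \<omega>))" by (simp add: \<theta>_Suc[OF \<omega>])
    also have "\<dots> \<le> F (\<theta> k \<omega>) + (- \<alpha> k *\<^sub>R g k \<omega>) \<bullet> grad F (\<theta> k \<omega>) + L / 2 * (norm (- \<alpha> k *\<^sub>R g k \<omega>))\<^sup>2"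
      by (rule F_descent)
    also have "\<dots> = ?u \<omega>"
      by (simp add: power_mult_distrib g_eq[OF \<omega>] align_def inner_commute)
    finally show "F (\<theta> (Suc k) \<omega>) \<le> ?u \<omega>" .
  qed
  also have "expectation ?u = expectation (\<lambda>\<omega>. F (\<theta> k \<omega>)) - \<alpha> k * expectation ?a
      + L / 2 * (\<alpha> k)\<^sup>2 * expectation (\<lambda>\<omega>. (norm (g k \<omega>))\<^sup>2)"
    using int objective_integrable[of k] expectation_align_quantized(1)[of k] by simp
  also have "\<dots> \<le> expectation (\<lambda>\<omega>. F (\<theta> k \<omega>))
      - \<alpha> k * (reception_prob * (\<alpha>\<^sub>2 * \<gamma> k * (expectation (\<lambda>\<omega>. (norm (grad F (\<theta> k \<omega>)))\<^sup>2) - (bias * \<gamma> k)\<^sup>2)))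
      + L / 2 * (\<alpha> k)\<^sup>2 * (4 * reception_prob * (\<sigma> + 1)\<^sup>2 * \<alpha>\<^sub>3 ^ 4 * (real N)\<^sup>2 * L\<^sub>\<xi> * (\<gamma> k)\<^sup>2)"
    using \<alpha>_pos[of k] L_pos
    by (intro add_mono diff_left_mono mult_left_mono expectation_align_quantized_ge g_moment(2)) auto
  finally show ?thesis .
qed

lemma weighted_gradient_sum:
  "reception_prob * \<alpha>\<^sub>2 * (\<Sum>k=0..K. \<alpha> k * \<gamma> k * expectation (\<lambda>\<omega>. (norm (grad F (\<theta> k \<omega>)))\<^sup>2))
    \<le> F \<theta>\<^sub>0 - F \<theta>star + reception_prob * \<alpha>\<^sub>2 * bias\<^sup>2 * (\<Sum>k=0..K. \<alpha> k * (\<gamma> k) ^ 3)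
      + L / 2 * (4 * reception_prob * (\<sigma> + 1)\<^sup>2 * \<alpha>\<^sub>3 ^ 4 * (real N)\<^sup>2 * L\<^sub>\<xi>) * (\<Sum>k=0..K. (\<alpha> k * \<gamma> k)\<^sup>2)"
proof -
  \<comment> \<open>The expected objective after the last step stays in the statement so that the
    sum telescopes; it is replaced by the minimum afterwards.\<close>
  have sum: "reception_prob * \<alpha>\<^sub>2 * (\<Sum>k=0..K. \<alpha> k * \<gamma> k * expectation (\<lambda>\<omega>. (norm (grad F (\<theta> k \<omega>)))\<^sup>2))
    \<le> expectation (\<lambda>\<omega>. F (\<theta> 0 \<omega>)) - expectation (\<lambda>\<omega>. F (\<theta> (Suc K) \<omega>))
      + reception_prob * \<alpha>\<^sub>2 * bias\<^sup>2 * (\<Sum>k=0..K. \<alpha> k * (\<gamma> k) ^ 3)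
      + L / 2 * (4 * reception_prob * (\<sigma> + 1)\<^sup>2 * \<alpha>\<^sub>3 ^ 4 * (real N)\<^sup>2 * L\<^sub>\<xi>) * (\<Sum>k=0..K. (\<alpha> k * \<gamma> k)\<^sup>2)"
  proof (induction K)
    case 0
    show ?case using expected_descent[of 0]
      by (simp add: algebra_simps power2_eq_square power3_eq_cube)
  next
    case (Suc K)
    then show ?case using expected_descent[of "Suc K"]
      by (simp add: algebra_simps power2_eq_square power3_eq_cube)
  qed
  have "expectation (\<lambda>\<omega>. F (\<theta> 0 \<omega>)) = expectation (\<lambda>_. F \<theta>\<^sub>0)"
    by (intro Bochner_Integration.integral_cong) (simp_all add: \<theta>_0)
  moreover have "expectation (\<lambda>_. F \<theta>star) \<le> expectation (\<lambda>\<omega>. F (\<theta> (Suc K) \<omega>))"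
    by (intro integral_mono objective_integrable \<theta>star_min) simp
  ultimately show ?thesis using sum by (simp add: prob_space)
qed

end

subsection \<open>Step sizes\<close>

text \<open>The mean value theorem on a unit interval stands in for comparing a summand with an
  integral: for \<open>a = 1 - s\<close> the right-hand side is a multiple of z^(-s), with
  \<open>z\<close> between two consecutive summation points.\<close>

lemma powr_Suc_diff:
  fixes x a :: real
  assumes "x > 0"
  obtains z where "x < z" "z < x + 1" "(x + 1) powr a - x powr a = a * z powr (a - 1)"
proof -
  have "DERIV (\<lambda>y. y powr a) y :> a * y powr (a - 1)" if "x \<le> y" for y
    using assms that by (intro has_real_derivative_powr) simp
  then obtain z where "x < z" "z < x + 1" "(x + 1) powr a - x powr a = (x + 1 - x) * (a * z powr (a - 1))"
    using MVT2[of x "x + 1" "\<lambda>y. y powr a" "\<lambda>y. a * y powr (a - 1)"] by auto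
  then show ?thesis using that by simp
qed

lemma sum_powr_upper:
  assumes s: "s > (1::real)"
  shows "(\<Sum>k=0..K. (1 + real k) powr (- s)) \<le> s / (s - 1)"
proof -
  \<comment> \<open>The induction needs the telescoping remainder. The leading 1 is the term
    \<open>k = 0\<close>, kept apart because the integral of x^(-s) from 0 diverges.\<close>
  have "(\<Sum>k=0..K. (1 + real k) powr (- s)) \<le> 1 + (1 - (real K + 1) powr (1 - s)) / (s - 1)"
  proof (induction K)
    case (Suc K)
    obtain z where z: "real K + 1 < z" "z < real K + 1 + 1"
      "(real K + 1 + 1) powr (1 - s) - (real K + 1) powr (1 - s) = (1 - s) * z powr (1 - s - 1)"
      by (rule powr_Suc_diff[of "real K + 1" "1 - s"]) auto
    have "(real K + 2) powr (- s) \<le> z powr (- s)"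
      using z s by (intro powr_mono2') auto
    then have "(s - 1) * (real K + 2) powr (- s) \<le> (s - 1) * z powr (- s)"
      using s by (intro mult_left_mono) auto
    also have "\<dots> = (real K + 1) powr (1 - s) - (real K + 2) powr (1 - s)"
      using z(3) by (simp add: algebra_simps)
    finally have "(real K + 2) powr (- s) \<le> ((real K + 1) powr (1 - s) - (real K + 2) powr (1 - s)) / (s - 1)"
      using s by (simp add: pos_le_divide_eq mult.commute)
    with Suc show ?case by (simp add: diff_divide_distrib add.commute)
  qed simp
  also have "\<dots> \<le> 1 + 1 / (s - 1)" using s by (intro add_left_mono divide_right_mono) auto
  also have "\<dots> = s / (s - 1)" using s by (simp add: field_simps)
  finally show ?thesis .
qed

text \<open>The summand at \<open>k\<close> dominates the integral of x^(-s) over [k+1, k+2], so the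
  last of the K+1 intervals ends at K+2.\<close>

lemma sum_powr_lower:
  assumes s: "0 < s" "s < (1::real)"
  shows "((real K + 2) powr (1 - s) - 1) / (1 - s) \<le> (\<Sum>k=0..K. (1 + real k) powr (- s))"
proof -
  have step: "((real k + 2) powr (1 - s) - (real k + 1) powr (1 - s)) / (1 - s) \<le> (1 + real k) powr (- s)" for k
  proof -
    obtain z where z: "real k + 1 < z" "z < real k + 1 + 1"
      "(real k + 1 + 1) powr (1 - s) - (real k + 1) powr (1 - s) = (1 - s) * z powr (1 - s - 1)"
      by (rule powr_Suc_diff[of "real k + 1" "1 - s"]) auto
    have "z powr (- s) \<le> (real k + 1) powr (- s)"
      using z s by (intro powr_mono2') auto
    then have "(1 - s) * z powr (- s) \<le> (1 - s) * (real k + 1) powr (- s)"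
      using s by (intro mult_left_mono) auto
    then show ?thesis
      using z(3) s by (simp add: pos_divide_le_eq algebra_simps)
  qed
  show ?thesis
  proof (induction K)
    case 0
    show ?case using step[of 0] by simp
  next
    case (Suc K)
    then show ?case using step[of "Suc K"] by (simp add: diff_divide_distrib add.commute)
  qed
qed

text \<open>The conclusion includes integrability because a non-integrable squared norm would have
  integral 0 by convention, which would make the bound meaningless.\<close>

theorem mainTheorem2:
  fixes M :: "'w measure" and N :: nat
    and D :: "nat \<Rightarrow> 'x measure" and f :: "nat \<Rightarrow> real^'d \<Rightarrow> 'x \<Rightarrow> real"
    and DQ :: "'q measure" and Q :: "'q \<Rightarrow> real \<Rightarrow> real"
    and \<Phi> :: "nat \<Rightarrow> 'w \<Rightarrow> real^'d" and \<xi> :: "nat \<Rightarrow> nat \<Rightarrow> 'w \<Rightarrow> 'x"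
    and S :: "nat \<Rightarrow> 'w \<Rightarrow> nat set"
    and \<zeta> :: "nat \<Rightarrow> nat \<Rightarrow> 'w \<Rightarrow> 'q" and \<eta> :: "nat \<Rightarrow> 'w \<Rightarrow> 'q"
    and \<theta> g :: "nat \<Rightarrow> 'w \<Rightarrow> real^'d" and \<Delta>f :: "nat \<Rightarrow> nat \<Rightarrow> 'w \<Rightarrow> real"
    and \<Delta>fs :: "nat \<Rightarrow> 'w \<Rightarrow> real"
    and \<alpha> \<gamma> :: "nat \<Rightarrow> real" and \<theta>\<^sub>0 \<theta>star :: "real^'d"
    and Lip :: "nat \<Rightarrow> 'x \<Rightarrow> real" and F :: "real^'d \<Rightarrow> real"
    and p L L\<^sub>\<xi> \<sigma> \<alpha>\<^sub>0 \<gamma>\<^sub>0 \<alpha>\<^sub>1 \<alpha>\<^sub>2 \<alpha>\<^sub>3 \<upsilon>\<^sub>1 \<upsilon>\<^sub>2 \<upsilon>\<^sub>3 q c\<^sub>1 c\<^sub>2 c\<^sub>3 \<delta>\<^sub>0 A\<^sub>0 A\<^sub>1 A\<^sub>2 :: real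
    and K :: nat
  assumes "prob_space M" and "N \<ge> 1" and "0 < p" and "p \<le> 1"
    \<comment> \<open>the random draws\<close>
    and \<Phi>_meas: "\<And>k. \<Phi> k \<in> borel_measurable M"
    and \<xi>_distr: "\<And>i k. i \<in> {1..N} \<Longrightarrow> \<xi> i k \<in> measurable M (D i) \<and> distr M (D i) (\<xi> i k) = D i"
    and S_meas: "\<And>k. S k \<in> measurable M (count_space (Pow {1..N}))"
    and S_prob: "\<And>i k. i \<in> {1..N} \<Longrightarrow> measure M {\<omega> \<in> space M. i \<in> S k \<omega>} = p"
    and S_indep: "\<And>k. prob_space.indep_events M (\<lambda>i. {\<omega> \<in> space M. i \<in> S k \<omega>}) {1..N}"
    and \<zeta>_distr: "\<And>i k. i \<in> {1..N} \<Longrightarrow> \<zeta> i k \<in> measurable M DQ \<and> distr M DQ (\<zeta> i k) = DQ"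
    and \<eta>_distr: "\<And>k. \<eta> k \<in> measurable M DQ \<and> distr M DQ (\<eta> k) = DQ"
    and draws_indep: "prob_space.indep_sets M (draw_events M N D DQ \<Phi> \<xi> S \<zeta> \<eta>) (draws N)"
    \<comment> \<open>the iteration\<close>
    and \<theta>_0: "\<And>\<omega>. \<omega> \<in> space M \<Longrightarrow> \<theta> 0 \<omega> = \<theta>\<^sub>0"
    and \<Delta>f_eq: "\<And>i k \<omega>. i \<in> {1..N} \<Longrightarrow> \<omega> \<in> space M \<Longrightarrow>
        \<Delta>f i k \<omega> = f i (\<theta> k \<omega> + \<gamma> k *\<^sub>R \<Phi> k \<omega>) (\<xi> i k \<omega>) - f i (\<theta> k \<omega> - \<gamma> k *\<^sub>R \<Phi> k \<omega>) (\<xi> i k \<omega>)"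
    and \<Delta>fs_eq: "\<And>k \<omega>. \<omega> \<in> space M \<Longrightarrow>
        \<Delta>fs k \<omega> = server_average N (S k \<omega>) (\<lambda>i. Q (\<zeta> i k \<omega>) (\<Delta>f i k \<omega>))"
    and g_eq: "\<And>k \<omega>. \<omega> \<in> space M \<Longrightarrow> g k \<omega> = Q (\<eta> k \<omega>) (\<Delta>fs k \<omega>) *\<^sub>R \<Phi> k \<omega>"
    and \<theta>_Suc: "\<And>k \<omega>. \<omega> \<in> space M \<Longrightarrow> \<theta> (Suc k) \<omega> = \<theta> k \<omega> - \<alpha> k *\<^sub>R g k \<omega>"
    \<comment> \<open>the objective and its minimizer\<close>
    and F_eq: "F = global_obj N D f"
    and \<theta>star_min: "\<And>t. F \<theta>star \<le> F t" and \<theta>star_grad: "grad F \<theta>star = 0"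
    \<comment> \<open>(1) smoothness\<close>
    and F_diff: "\<And>i t. i \<in> {1..N} \<Longrightarrow> local_obj D f i differentiable (at t)"
    and F_diff2: "\<And>i t. i \<in> {1..N} \<Longrightarrow> grad (local_obj D f i) differentiable (at t)"
    and grad_cont: "\<And>i. i \<in> {1..N} \<Longrightarrow> continuous_on UNIV (grad (local_obj D f i))"
    and hess_cont: "\<And>i. i \<in> {1..N} \<Longrightarrow> continuous_on UNIV (hessian (local_obj D f i))"
    and "\<alpha>\<^sub>1 > 0"
    and hess_bound: "\<And>i t. i \<in> {1..N} \<Longrightarrow> spectral_norm (hessian (local_obj D f i) t) \<le> \<alpha>\<^sub>1"
    and "L > 0" and F_smooth: "\<And>t t'. norm (grad F t - grad F t') \<le> L * norm (t - t')"
    \<comment> \<open>(2) Lipschitz continuity of the sample losses\<close>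
    and f_Lip: "\<And>i t t' x. i \<in> {1..N} \<Longrightarrow> x \<in> space (D i) \<Longrightarrow>
        \<bar>f i t x - f i t' x\<bar> \<le> Lip i x * norm (t - t')"
    and Lip_meas: "\<And>i. i \<in> {1..N} \<Longrightarrow> Lip i \<in> borel_measurable (D i)"
    and "L\<^sub>\<xi> \<ge> 0"
    and L\<^sub>\<xi>_eq: "\<And>k. AE \<omega> in M. ennreal L\<^sub>\<xi> =
        Max ((\<lambda>i. nn_cond_exp M (history M N D \<theta> \<xi> k) (\<lambda>\<omega>'. ennreal ((Lip i (\<xi> i k \<omega>'))\<^sup>2)) \<omega>) ` {1..N})"
    and f_int: "\<And>i t. i \<in> {1..N} \<Longrightarrow> integrable (D i) (f i t)"
    \<comment> \<open>(3) step sizes\<close>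
    and \<alpha>_eq: "\<And>k. \<alpha> k = \<alpha>\<^sub>0 * (1 + real k) powr (- \<upsilon>\<^sub>1)"
    and \<gamma>_eq: "\<And>k. \<gamma> k = \<gamma>\<^sub>0 * (1 + real k) powr (- \<upsilon>\<^sub>2)"
    and "\<alpha>\<^sub>0 > 0" and "\<gamma>\<^sub>0 > 0" and "\<upsilon>\<^sub>1 > 0" and "\<upsilon>\<^sub>2 > 0"
    and "\<upsilon>\<^sub>3 = \<upsilon>\<^sub>1 + \<upsilon>\<^sub>2" and "0.5 < \<upsilon>\<^sub>3" and "\<upsilon>\<^sub>3 < 1" and "\<upsilon>\<^sub>1 + 3 * \<upsilon>\<^sub>2 > 1"
    \<comment> \<open>(4) the quantizer\<close>
    and "\<sigma> > 0" and Q_unbiased: "unbiased_quantizer DQ Q \<sigma>"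
    \<comment> \<open>(5) the perturbation vectors\<close>
    and \<Phi>_indep: "\<And>k. prob_space.indep_vars M (\<lambda>_. borel) (\<lambda>j \<omega>. \<Phi> k \<omega> $ j) UNIV"
    and \<Phi>_ident: "\<And>k j j'. distr M borel (\<lambda>\<omega>. \<Phi> k \<omega> $ j) = distr M borel (\<lambda>\<omega>. \<Phi> k \<omega> $ j')"
    and \<Phi>_uncorr: "\<And>k j j'. j \<noteq> j' \<Longrightarrow> (\<integral>\<omega>. \<Phi> k \<omega> $ j * \<Phi> k \<omega> $ j' \<partial>M) = 0"
    and "\<alpha>\<^sub>2 > 0" and \<Phi>_var: "\<And>k j. (\<integral>\<omega>. (\<Phi> k \<omega> $ j)\<^sup>2 \<partial>M) = \<alpha>\<^sub>2"
    and "\<alpha>\<^sub>3 > 0" and \<Phi>_bound: "\<And>k. AE \<omega> in M. norm (\<Phi> k \<omega>) \<le> \<alpha>\<^sub>3"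
    \<comment> \<open>the constants\<close>
    and "q = 1 - (1 - p) ^ N"
    and "c\<^sub>1 = 2 * q * \<alpha>\<^sub>2"
    and "c\<^sub>2 = 4 * q * (\<sigma> + 1)\<^sup>2 * \<alpha>\<^sub>3 ^ 4 * (real N)\<^sup>2 * L\<^sub>\<xi>"
    and "c\<^sub>3 = \<alpha>\<^sub>1 * \<alpha>\<^sub>3 ^ 3 * real N / (2 * \<alpha>\<^sub>2)"
    and "\<delta>\<^sub>0 = F \<theta>\<^sub>0 - F \<theta>star"
    and "A\<^sub>0 = 2 * \<delta>\<^sub>0 / (c\<^sub>1 * \<alpha>\<^sub>0 * \<gamma>\<^sub>0)"
    and "A\<^sub>1 = (\<upsilon>\<^sub>1 + 3 * \<upsilon>\<^sub>2) * (c\<^sub>3 * \<gamma>\<^sub>0)\<^sup>2"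
    and "A\<^sub>2 = 2 * \<upsilon>\<^sub>3 * c\<^sub>2 * \<alpha>\<^sub>0 * \<gamma>\<^sub>0 * L / c\<^sub>1"
    and "K \<ge> 1"
  shows "(\<forall>k. integrable M (\<lambda>\<omega>. (norm (grad F (\<theta> k \<omega>)))\<^sup>2)) \<and>
    (\<Sum>k=0..K. \<alpha> k * \<gamma> k * (\<integral>\<omega>. (norm (grad F (\<theta> k \<omega>)))\<^sup>2 \<partial>M)) / (\<Sum>k=0..K. \<alpha> k * \<gamma> k)
      \<le> (1 - \<upsilon>\<^sub>3) / ((real K + 2) powr (1 - \<upsilon>\<^sub>3) - 1)
          * (A\<^sub>0 + A\<^sub>1 / (\<upsilon>\<^sub>1 + 3 * \<upsilon>\<^sub>2 - 1) + A\<^sub>2 / (2 * \<upsilon>\<^sub>3 - 1))"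
proof -
  have \<alpha>_pos: "\<And>k. \<alpha> k > 0" and \<gamma>_pos: "\<And>k. \<gamma> k > 0"
    using \<open>\<alpha>\<^sub>0 > 0\<close> \<open>\<gamma>\<^sub>0 > 0\<close> by (simp_all add: \<alpha>_eq \<gamma>_eq)
  interpret dzofl M N D f DQ Q \<Phi> \<xi> S \<zeta> \<eta> \<theta> g \<Delta>f \<Delta>fs \<alpha> \<gamma> \<theta>\<^sub>0 \<theta>star Lip F p L L\<^sub>\<xi> \<sigma> \<alpha>\<^sub>1 \<alpha>\<^sub>2 \<alpha>\<^sub>3
    by (rule dzofl.intro, fact, rule dzofl_axioms.intro) (fact assms \<alpha>_pos \<gamma>_pos)+
  let ?s = "\<upsilon>\<^sub>1 + 3 * \<upsilon>\<^sub>2"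
  let ?S1 = "\<Sum>k=0..K. \<alpha> k * (\<gamma> k) ^ 3"
  let ?S2 = "\<Sum>k=0..K. (\<alpha> k * \<gamma> k)\<^sup>2"
  let ?T = "\<Sum>k=0..K. \<alpha> k * \<gamma> k"
  let ?X = "\<Sum>k=0..K. \<alpha> k * \<gamma> k * (\<integral>\<omega>. (norm (grad F (\<theta> k \<omega>)))\<^sup>2 \<partial>M)"
  let ?R = "((real K + 2) powr (1 - \<upsilon>\<^sub>3) - 1) / (1 - \<upsilon>\<^sub>3)"
  let ?B = "A\<^sub>0 + A\<^sub>1 / (?s - 1) + A\<^sub>2 / (2 * \<upsilon>\<^sub>3 - 1)"
  have \<upsilon>\<^sub>3: "1 - \<upsilon>\<^sub>3 > 0" "2 * \<upsilon>\<^sub>3 > 1" and s: "?s > 1" using assms by auto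
  have c\<^sub>1: "c\<^sub>1 > 0" and c\<^sub>2: "c\<^sub>2 \<ge> 0"
    using assms reception_prob_pos by auto
  have step: "\<alpha> k * \<gamma> k = \<alpha>\<^sub>0 * \<gamma>\<^sub>0 * (1 + real k) powr (- \<upsilon>\<^sub>3)" for k
    by (simp add: \<alpha>_eq \<gamma>_eq \<open>\<upsilon>\<^sub>3 = \<upsilon>\<^sub>1 + \<upsilon>\<^sub>2\<close> powr_add[symmetric] ac_simps)
  have "(\<alpha> k * \<gamma> k)\<^sup>2 = (\<alpha>\<^sub>0 * \<gamma>\<^sub>0)\<^sup>2 * (1 + real k) powr (- (2 * \<upsilon>\<^sub>3))" for k
    unfolding step by (simp add: power2_eq_square powr_add[symmetric])
  then have "?S2 = (\<alpha>\<^sub>0 * \<gamma>\<^sub>0)\<^sup>2 * (\<Sum>k=0..K. (1 + real k) powr (- (2 * \<upsilon>\<^sub>3)))"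
    by (simp add: sum_distrib_left)
  also have "\<dots> \<le> (\<alpha>\<^sub>0 * \<gamma>\<^sub>0)\<^sup>2 * (2 * \<upsilon>\<^sub>3 / (2 * \<upsilon>\<^sub>3 - 1))"
    using \<upsilon>\<^sub>3 by (intro mult_left_mono sum_powr_upper) auto
  finally have S2: "?S2 \<le> (\<alpha>\<^sub>0 * \<gamma>\<^sub>0)\<^sup>2 * (2 * \<upsilon>\<^sub>3 / (2 * \<upsilon>\<^sub>3 - 1))" .
  have "\<alpha> k * (\<gamma> k) ^ 3 = \<alpha>\<^sub>0 * \<gamma>\<^sub>0 ^ 3 * (1 + real k) powr (- ?s)" for k
    by (simp add: \<alpha>_eq \<gamma>_eq power3_eq_cube powr_add[symmetric] ac_simps)
  then have "?S1 = \<alpha>\<^sub>0 * \<gamma>\<^sub>0 ^ 3 * (\<Sum>k=0..K. (1 + real k) powr (- ?s))"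
    by (simp add: sum_distrib_left)
  also have "\<dots> \<le> \<alpha>\<^sub>0 * \<gamma>\<^sub>0 ^ 3 * (?s / (?s - 1))"
    using s \<open>\<alpha>\<^sub>0 > 0\<close> \<open>\<gamma>\<^sub>0 > 0\<close> by (intro mult_left_mono sum_powr_upper) auto
  finally have S1: "?S1 \<le> \<alpha>\<^sub>0 * \<gamma>\<^sub>0 ^ 3 * (?s / (?s - 1))" .
  have "\<alpha>\<^sub>0 * \<gamma>\<^sub>0 * ?R \<le> \<alpha>\<^sub>0 * \<gamma>\<^sub>0 * (\<Sum>k=0..K. (1 + real k) powr (- \<upsilon>\<^sub>3))"
    using \<upsilon>\<^sub>3 \<open>\<alpha>\<^sub>0 > 0\<close> \<open>\<gamma>\<^sub>0 > 0\<close> by (intro mult_left_mono sum_powr_lower) auto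
  then have T: "\<alpha>\<^sub>0 * \<gamma>\<^sub>0 * ?R \<le> ?T" by (simp add: step sum_distrib_left)
  have "1 < (real K + 2) powr (1 - \<upsilon>\<^sub>3)" using \<upsilon>\<^sub>3 by (intro gr_one_powr) auto
  then have R: "?R > 0" using \<upsilon>\<^sub>3 by simp
  have "c\<^sub>1 / 2 * ?X \<le> \<delta>\<^sub>0 + c\<^sub>1 / 2 * c\<^sub>3\<^sup>2 * ?S1 + L / 2 * c\<^sub>2 * ?S2"
  proof -
    have "reception_prob * \<alpha>\<^sub>2 = c\<^sub>1 / 2" "bias = c\<^sub>3"
      "4 * reception_prob * (\<sigma> + 1)\<^sup>2 * \<alpha>\<^sub>3 ^ 4 * (real N)\<^sup>2 * L\<^sub>\<xi> = c\<^sub>2"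
      using assms by (simp_all add: bias_def)
    then show ?thesis using weighted_gradient_sum[of K] \<open>\<delta>\<^sub>0 = F \<theta>\<^sub>0 - F \<theta>star\<close> by metis
  qed
  then have "?X \<le> (\<delta>\<^sub>0 + c\<^sub>1 / 2 * c\<^sub>3\<^sup>2 * ?S1 + L / 2 * c\<^sub>2 * ?S2) / (c\<^sub>1 / 2)"
    using c\<^sub>1 by (simp add: pos_le_divide_eq mult.commute)
  also have "\<dots> = 2 * \<delta>\<^sub>0 / c\<^sub>1 + c\<^sub>3\<^sup>2 * ?S1 + L * c\<^sub>2 / c\<^sub>1 * ?S2"
    using c\<^sub>1 by (simp add: field_simps)
  also have "\<dots> \<le> 2 * \<delta>\<^sub>0 / c\<^sub>1 + c\<^sub>3\<^sup>2 * (\<alpha>\<^sub>0 * \<gamma>\<^sub>0 ^ 3 * (?s / (?s - 1)))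
      + L * c\<^sub>2 / c\<^sub>1 * ((\<alpha>\<^sub>0 * \<gamma>\<^sub>0)\<^sup>2 * (2 * \<upsilon>\<^sub>3 / (2 * \<upsilon>\<^sub>3 - 1)))"
    using c\<^sub>1 c\<^sub>2 \<open>L > 0\<close> by (intro add_mono mult_left_mono S1 S2) auto
  \<comment> \<open>The factor is taken out because the lower bound for \<open>?T\<close> carries it
    too. This cancellation fixes the powers of \<open>\<alpha>\<^sub>0\<close> and
    \<open>\<gamma>\<^sub>0\<close> in \<open>A\<^sub>0\<close>, \<open>A\<^sub>1\<close> and
    \<open>A\<^sub>2\<close>.\<close>
  also have "\<dots> = \<alpha>\<^sub>0 * \<gamma>\<^sub>0 * ?B"
  proof -
    have "2 * \<delta>\<^sub>0 / c\<^sub>1 = \<alpha>\<^sub>0 * \<gamma>\<^sub>0 * A\<^sub>0"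
      using \<open>\<alpha>\<^sub>0 > 0\<close> \<open>\<gamma>\<^sub>0 > 0\<close> by (simp add: \<open>A\<^sub>0 = _\<close>)
    moreover have "c\<^sub>3\<^sup>2 * (\<alpha>\<^sub>0 * \<gamma>\<^sub>0 ^ 3 * (?s / (?s - 1))) = \<alpha>\<^sub>0 * \<gamma>\<^sub>0 * (A\<^sub>1 / (?s - 1))"
      by (simp add: \<open>A\<^sub>1 = _\<close> power2_eq_square power3_eq_cube)
    moreover have "L * c\<^sub>2 / c\<^sub>1 * ((\<alpha>\<^sub>0 * \<gamma>\<^sub>0)\<^sup>2 * (2 * \<upsilon>\<^sub>3 / (2 * \<upsilon>\<^sub>3 - 1)))
        = \<alpha>\<^sub>0 * \<gamma>\<^sub>0 * (A\<^sub>2 / (2 * \<upsilon>\<^sub>3 - 1))"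
      by (simp add: \<open>A\<^sub>2 = _\<close> power2_eq_square)
    ultimately show ?thesis by (simp add: distrib_left)
  qed
  finally have X: "?X \<le> \<alpha>\<^sub>0 * \<gamma>\<^sub>0 * ?B" .
  \<comment> \<open>The upper bound for \<open>?X\<close> thereby is nonnegative as well, which is
    what permits replacing the denominator by its lower bound.\<close>
  have "0 \<le> ?X"
    using \<alpha>_pos \<gamma>_pos
    by (intro sum_nonneg mult_nonneg_nonneg Bochner_Integration.integral_nonneg) (auto intro: less_imp_le)
  from order_trans[OF this X] X mult_pos_pos[OF mult_pos_pos[OF \<open>\<alpha>\<^sub>0 > 0\<close> \<open>\<gamma>\<^sub>0 > 0\<close>] R] T
  have "?X / ?T \<le> (\<alpha>\<^sub>0 * \<gamma>\<^sub>0 * ?B) / (\<alpha>\<^sub>0 * \<gamma>\<^sub>0 * ?R)" by (rule frac_le)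
  also have "\<dots> = ?B / ?R" using \<open>\<alpha>\<^sub>0 > 0\<close> \<open>\<gamma>\<^sub>0 > 0\<close> by simp
  also have "\<dots> = (1 - \<upsilon>\<^sub>3) / ((real K + 2) powr (1 - \<upsilon>\<^sub>3) - 1) * ?B" by simp
  finally show ?thesis using grad_square_integrable by blast
qed

end
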